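(* Let $K,L\subset\mathbb R^n$ be convex bodies. Then $$|K+L|\,M(K,L)\ \le\ \binom{2n}{n}|K|\,|L|.$$ Equality holds if and only if $K$ is a simplex and $K$ is a translate of $-L$.
   Context: A convex body in $\mathbb R^n$ is a compact convex set with non-empty interior; $|\cdot|$ denotes Lebesgue measure. $K+L$ is the Minkowski sum and $M(K,L)=\sup_{x\in K+L}|K\cap(x-L)|$. *)

theory Defs
  imports "HOL-Analysis.Analysis"
begin

definition convex_body :: "'a::euclidean_space set \<Rightarrow> bool" where
  "convex_body K \<longleftrightarrow> compact K \<and> convex K \<and> interior K \<noteq> {}"

text \<open>
  Sums of sets are Minkowski sums. The reflections \<open>x - L\<close> and \<open>-L\<close> are written as
  images, because \<open>- L\<close> on sets is the complement. For compact \<open>K\<close> the measures below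
  are finite and bounded by that of \<open>K\<close>, so for nonempty \<open>K\<close> and \<open>L\<close> the real-valued
  supremum is the true one.
\<close>
definition max_section :: "'a::euclidean_space set \<Rightarrow> 'a set \<Rightarrow> real" where
  "max_section K L = (SUP x \<in> K + L. measure lebesgue (K \<inter> (\<lambda>y. x - y) ` L))"

definition translate_of :: "'a::real_vector set \<Rightarrow> 'a set \<Rightarrow> bool" where
  "translate_of A B \<longleftrightarrow> (\<exists>a. A = (\<lambda>y. a + y) ` B)"

end

theory Submission
  imports Defs
begin

text \<open>
  Put \<open>A = K\<close> and \<open>B = x\<^sub>0 - L\<close>, where \<open>x\<^sub>0\<close> maximizes the section volume, and
  \<open>F x = |A \<inter> (x + B)|\<close>. For \<open>y \<in> A - B\<close> pick \<open>p \<in> A \<inter> (y + B)\<close>; by convexity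
  \<open>A \<inter> (t y + B)\<close> contains \<open>(1 - t) (A \<inter> B) + t p\<close>, so \<open>F (t y) \<ge> (1 - t)^n F 0\<close>.
  Integrating along rays and using that \<open>F\<close> has integral \<open>|A| |B|\<close> gives the inequality.

  In the equality case every overlap \<open>A \<inter> (t y + B)\<close>, with \<open>y\<close> on the frontier of \<open>A - B\<close>, equals
  \<open>(1 - t) (A \<inter> B) + t p\<close>. A supporting hyperplane argument then gives \<open>A = B\<close>. The homothety of the
  overlaps \<open>A \<inter> (x + A)\<close> is a Riesz decomposition property of the cone over \<open>A\<close>; it makes the
  extreme points of \<open>A\<close> affinely independent. Conversely, barycentric coordinates show that the
  overlaps of a simplex with its translates are homothetic to it, so that equality holds throughout.
\<close>

section \<open>Overlaps of convex bodies\<close>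

definition overlap :: "'a::real_vector set \<Rightarrow> 'a set \<Rightarrow> 'a \<Rightarrow> 'a set" where
  "overlap A B x = {z \<in> A. z - x \<in> B}"

definition difference_body :: "'a::real_vector set \<Rightarrow> 'a set \<Rightarrow> 'a set" where
  "difference_body A B = {a - b | a b. a \<in> A \<and> b \<in> B}"

text \<open>Only one inclusion is recorded: for convex \<open>A\<close> and \<open>B\<close> the
  reverse one always holds, by \<open>overlap_combine\<close> with a point of
  \<open>A \<inter> B\<close>, which is the overlap at 0.\<close>

definition homothetic_overlaps :: "'a::euclidean_space set \<Rightarrow> 'a set \<Rightarrow> bool" where
  "homothetic_overlaps A B \<longleftrightarrow>
     (\<forall>y \<in> frontier (difference_body A B). \<forall>p \<in> overlap A B y. \<forall>t \<in> {0..<1}.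
        overlap A B (t *\<^sub>R y) \<subseteq> (\<lambda>d. (1 - t) *\<^sub>R d + t *\<^sub>R p) ` (A \<inter> B))"

lemma overlap_nonempty_iff: "overlap A B x \<noteq> {} \<longleftrightarrow> x \<in> difference_body A B"
proof
  assume "overlap A B x \<noteq> {}"
  then obtain z where "z \<in> A" "z - x \<in> B" by (auto simp: overlap_def)
  then show "x \<in> difference_body A B"
    unfolding difference_body_def by (intro CollectI exI[of _ z] exI[of _ "z - x"]) auto
qed (auto simp: overlap_def difference_body_def)

lemma overlap_zero [simp]: "overlap A B 0 = A \<inter> B"
  by (auto simp: overlap_def)

lemma overlap_combine:
  assumes "convex A" "convex B" "0 \<le> t" "t \<le> 1" "z \<in> overlap A B x" "p \<in> overlap A B y"
  shows "(1 - t) *\<^sub>R z + t *\<^sub>R p \<in> overlap A B ((1 - t) *\<^sub>R x + t *\<^sub>R y)"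
proof -
  have "(1 - t) *\<^sub>R z + t *\<^sub>R p - ((1 - t) *\<^sub>R x + t *\<^sub>R y) = (1 - t) *\<^sub>R (z - x) + t *\<^sub>R (p - y)"
    by (simp add: algebra_simps)
  with assms show ?thesis
    by (auto simp: overlap_def intro!: convexD)
qed

lemma difference_body_swap: "difference_body B A = uminus ` difference_body A B"
proof -
  have "b - a \<in> uminus ` difference_body A B" if "a \<in> A" "b \<in> B" for a b
    using that by (intro image_eqI[of _ _ "a - b"]) (auto simp: difference_body_def)
  moreover have "- (a - b) \<in> difference_body B A" if "a \<in> A" "b \<in> B" for a b
    using that by (auto simp: difference_body_def)
  ultimately show ?thesis by (auto simp: difference_body_def)
qed

lemma compact_difference_body:
  fixes A B :: "'a::real_normed_vector set"
  shows "compact A \<Longrightarrow> compact B \<Longrightarrow> compact (difference_body A B)"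
  using compact_differences[of A B] by (simp add: difference_body_def)

lemma convex_difference_body: "convex A \<Longrightarrow> convex B \<Longrightarrow> convex (difference_body A B)"
  using convex_differences[of A B]
  by (rule back_subst[of convex]) (auto simp: difference_body_def)

lemma zero_interior_difference_body:
  fixes A B :: "'a::real_normed_vector set"
  assumes "interior (A \<inter> B) \<noteq> {}"
  shows "0 \<in> interior (difference_body A B)"
proof -
  obtain c where c: "c \<in> interior A" "c \<in> B" using assms interior_subset by fastforce
  let ?U = "(\<lambda>a. - c + a) ` interior A"
  have "open ?U" using open_translation by blast
  moreover have "0 \<in> ?U" using c by (intro image_eqI[of _ _ c]) auto
  moreover have "?U \<subseteq> difference_body A B"
  proof
    fix x assume "x \<in> ?U"
    then obtain a where "a \<in> interior A" "x = a - c" by auto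
    then show "x \<in> difference_body A B"
      using c interior_subset[of A] by (auto simp: difference_body_def)
  qed
  ultimately show ?thesis by (meson interior_maximal subsetD)
qed

lemma difference_body_convex_body:
  fixes A B :: "'a::real_normed_vector set"
  assumes "compact A" "convex A" "compact B" "convex B" "interior (A \<inter> B) \<noteq> {}"
  shows "compact (difference_body A B)" "convex (difference_body A B)" "0 \<in> interior (difference_body A B)"
  by (rule compact_difference_body[OF assms(1,3)] convex_difference_body[OF assms(2,4)]
      zero_interior_difference_body[OF assms(5)])+

text \<open>Translation by \<open>- x\<close> carries \<open>overlap B A x\<close> onto
  \<open>overlap A B (- x)\<close>, and swapping the bodies reflects the difference body together
  with its frontier.\<close>

lemma homothetic_overlaps_swap:
  assumes "homothetic_overlaps A B"
  shows "homothetic_overlaps B A"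
  unfolding homothetic_overlaps_def
proof (intro ballI subsetI)
  fix y p t z
  assume y: "y \<in> frontier (difference_body B A)" and p: "p \<in> overlap B A y"
    and t: "t \<in> {0..<1::real}" and z: "z \<in> overlap B A (t *\<^sub>R y)"
  have "frontier (difference_body B A) = uminus ` frontier (difference_body A B)"
    unfolding difference_body_swap[of B A] frontier_def image_set_diff[OF inj_uminus] interior_negations
    using closure_injective_linear_image[OF linear_uminus inj_uminus] by metis
  then have "- y \<in> frontier (difference_body A B)" using y by auto
  moreover have "p - y \<in> overlap A B (- y)" using p by (auto simp: overlap_def)
  moreover have "z - t *\<^sub>R y \<in> overlap A B (t *\<^sub>R - y)" using z by (auto simp: overlap_def)
  ultimately obtain d where d: "d \<in> A \<inter> B" "z - t *\<^sub>R y = (1 - t) *\<^sub>R d + t *\<^sub>R (p - y)"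
    using assms t unfolding homothetic_overlaps_def by blast
  then have "z = (1 - t) *\<^sub>R d + t *\<^sub>R p" by (simp add: algebra_simps)
  with d show "z \<in> (\<lambda>d. (1 - t) *\<^sub>R d + t *\<^sub>R p) ` (B \<inter> A)" by auto
qed

section \<open>Rays from the origin and the frontier of a convex body\<close>

lemma shrink_mem_interior:
  fixes S :: "'a::euclidean_space set"
  assumes "convex S" "0 \<in> interior S" "x \<in> S" "0 \<le> s" "s < 1"
  shows "s *\<^sub>R x \<in> interior S"
  using mem_interior_convex_shrink[of S 0 x "1 - s"] assms by (simp add: algebra_simps)

text \<open>The ray through \<open>x\<close> leaves the bounded set \<open>Q\<close> at some
  \<open>d *\<^sub>R x\<close>, and \<open>d < 1\<close> is impossible because shrinking a point of
  \<open>Q\<close> lands in the interior. The resulting \<open>t\<close> is the gauge of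
  \<open>x\<close>.\<close>

lemma obtain_frontier_multiple:
  fixes Q :: "'a::euclidean_space set"
  assumes "compact Q" "convex Q" "0 \<in> interior Q" "x \<in> Q"
  obtains t y where "y \<in> frontier Q" "0 \<le> t" "t \<le> 1" "x = t *\<^sub>R y"
proof -
  \<comment> \<open>For \<open>x = 0\<close> any nonzero direction serves, with multiple 0.\<close>
  define l where "l = (if x = 0 then (SOME b. b \<in> Basis) else x)"
  have l0: "l \<noteq> 0" unfolding l_def by (auto simp: SOME_Basis nonzero_Basis)
  obtain d where d: "0 < d" "0 + d *\<^sub>R l \<in> frontier Q"
    using ray_to_frontier[OF compact_imp_bounded[OF assms(1)] assms(3) l0] by blast
  show thesis
  proof (cases "x = 0")
    case True then show ?thesis using d that[of "d *\<^sub>R l" 0] by auto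
  next
    case False
    then have dx: "d *\<^sub>R x \<in> frontier Q" using d by (simp add: l_def)
    have "d \<ge> 1"
    proof (rule ccontr)
      assume "\<not> d \<ge> 1"
      then have "d *\<^sub>R x \<in> interior Q" using shrink_mem_interior[OF assms(2-4), of d] d(1) by simp
      with dx show False by (simp add: frontier_def)
    qed
    then show ?thesis using that[of "d *\<^sub>R x" "1 / d"] dx by auto
  qed
qed

text \<open>The gauge of a frontier point is at least 1: otherwise \<open>y\<close> would be a
  proper shrinking of a point of \<open>Q\<close>, hence interior.\<close>

lemma scale_le_of_frontier_mem:
  fixes Q :: "'a::euclidean_space set"
  assumes "convex Q" "0 \<in> interior Q" "y \<in> frontier Q" "0 \<le> s" "t *\<^sub>R y \<in> (*\<^sub>R) s ` Q"
  shows "t \<le> s"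
proof (rule ccontr)
  assume "\<not> t \<le> s"
  then have st: "s < t" "0 < t" using assms by auto
  obtain q where q: "q \<in> Q" "t *\<^sub>R y = s *\<^sub>R q" using assms by auto
  have "y = (1 / t) *\<^sub>R (t *\<^sub>R y)" using st by simp
  also have "\<dots> = (s / t) *\<^sub>R q" using q by simp
  finally have "y \<in> interior Q"
    using shrink_mem_interior[OF assms(1,2) q(1), of "s / t"] st assms(4) by simp
  with assms show False by (simp add: frontier_def)
qed

lemma maximum_point_in_frontier:
  fixes Q :: "'a::euclidean_space set"
  assumes "u \<noteq> 0" "y \<in> Q" "\<And>x. x \<in> Q \<Longrightarrow> inner u x \<le> inner u y"
  shows "y \<in> frontier Q"
proof -
  have "y \<notin> interior Q"
  proof
    assume "y \<in> interior Q"
    then obtain e where e: "e > 0" "cball y e \<subseteq> Q" by (auto simp: mem_interior_cball)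
    have "y + (e / norm u) *\<^sub>R u \<in> Q" using e assms(1) by (intro subsetD[OF e(2)]) (auto simp: dist_norm)
    from assms(3)[OF this] have "(e / norm u) * inner u u \<le> 0" by (simp add: inner_add_right)
    moreover have "(e / norm u) * inner u u > 0" using e assms(1) by simp
    ultimately show False by simp
  qed
  with assms(2) closure_subset show ?thesis by (auto simp: frontier_def)
qed

text \<open>A frontier point of \<open>B\<close> interior to \<open>A\<close>, with outer normal \<open>u\<close>, stays in the overlap under
  small translations of \<open>B\<close>. For the translation maximizing \<open>u\<close>, homothety of the overlap forces
  \<open>u\<close> to be constant on \<open>B\<close>.\<close>

lemma homothetic_overlaps_subset:
  fixes A B :: "'a::euclidean_space set"
  assumes A: "compact A" "convex A" and B: "compact B" "convex B"
    and int: "interior (A \<inter> B) \<noteq> {}" and hom: "homothetic_overlaps A B"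
  shows "A \<subseteq> B"
proof
  fix q assume q: "q \<in> A"
  show "q \<in> B"
  proof (rule ccontr)
    assume qB: "q \<notin> B"
    obtain c where c: "c \<in> interior A" "c \<in> interior B" using int by auto
    have "q - c \<noteq> 0" using c qB interior_subset by auto
    then obtain e where e: "0 < e" "c + e *\<^sub>R (q - c) \<in> frontier B"
      "\<And>e'. 0 \<le> e' \<Longrightarrow> e' < e \<Longrightarrow> c + e' *\<^sub>R (q - c) \<in> interior B"
      using ray_to_frontier[OF compact_imp_bounded[OF B(1)] c(2)] by metis
    \<comment> \<open>The point where the segment from \<open>c\<close> to \<open>q\<close> leaves
      \<open>B\<close>. It comes strictly before \<open>q\<close>, so it is interior to
      \<open>A\<close>.\<close>
    define d where "d = c + e *\<^sub>R (q - c)"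
    have dB: "d \<in> B" "d \<notin> interior B"
      using e(2) B(1) compact_imp_closed frontier_subset_closed unfolding d_def frontier_def by auto
    have "e < 1"
    proof (rule ccontr)
      assume "\<not> e < 1"
      then consider "e = 1" | "1 < e" by linarith
      then show False
      proof cases
        case 1 then show False using dB qB by (simp add: d_def)
      next
        case 2
        have "q \<in> interior B" using e(3)[of 1] 2 by simp
        then show False using qB interior_subset by auto
      qed
    qed
    then have dA: "d \<in> interior A"
      using mem_interior_convex_shrink[OF A(2) c(1) q, of "1 - e"] e(1)
      by (simp add: d_def algebra_simps)
    have "d \<notin> rel_interior B"
      using dB rel_interior_nonempty_interior[of B] c by auto
    then obtain a where a: "a \<noteq> 0" "\<And>b. b \<in> B \<Longrightarrow> inner a d \<le> inner a b"
      using supporting_hyperplane_rel_boundary[OF B(2) dB(1)] by metis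
    define u where "u = - a"
    have u: "u \<noteq> 0" "\<And>b. b \<in> B \<Longrightarrow> inner u b \<le> inner u d" using a by (auto simp: u_def)
    have "A \<noteq> {}" "B \<noteq> {}" using c interior_subset by auto
    have cont: "continuous_on S (inner u)" for S by (intro continuous_intros)
    \<comment> \<open>Maximizing over \<open>A\<close> and minimizing over \<open>B\<close> makes
      \<open>k - l\<close> maximize \<open>inner u\<close> over the difference body.\<close>
    obtain k where k: "k \<in> A" "\<And>x. x \<in> A \<Longrightarrow> inner u x \<le> inner u k"
      using continuous_attains_sup[OF A(1) \<open>A \<noteq> {}\<close> cont] by blast
    obtain l where l: "l \<in> B" "\<And>x. x \<in> B \<Longrightarrow> inner u l \<le> inner u x"
      using continuous_attains_inf[OF B(1) \<open>B \<noteq> {}\<close> cont] by blast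
    define y where "y = k - l"
    have yQ: "y \<in> difference_body A B" using k l by (auto simp: difference_body_def y_def)
    have "y \<in> frontier (difference_body A B)"
      using u(1) yQ
    proof (rule maximum_point_in_frontier)
      fix x assume "x \<in> difference_body A B"
      then obtain a b where "a \<in> A" "b \<in> B" "x = a - b" by (auto simp: difference_body_def)
      then show "inner u x \<le> inner u y"
        using k(2)[of a] l(2)[of b] by (simp add: y_def inner_diff_right)
    qed
    moreover have "k \<in> overlap A B y" using k l by (simp add: overlap_def y_def)
    moreover obtain t where t: "0 < t" "t < 1" "d + t *\<^sub>R y \<in> A"
    proof -
      obtain r where r: "r > 0" "ball d r \<subseteq> A" using dA by (auto simp: mem_interior)
      define t where "t = min (1/2) (r / (2 * (norm y + 1)))"
      have "0 < norm y + 1" by (simp add: add_nonneg_pos)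
      then have t0: "0 < t" using r by (auto simp: t_def)
      have "t * norm y \<le> r / (2 * (norm y + 1)) * norm y"
        by (intro mult_right_mono) (auto simp: t_def)
      also have "\<dots> < r" using r \<open>0 < norm y + 1\<close> by (simp add: field_simps) (simp add: add_nonneg_pos)
      finally have "d + t *\<^sub>R y \<in> A" using t0 by (intro subsetD[OF r(2)]) (auto simp: dist_norm)
      then show thesis using that[of t] t0 by (auto simp: t_def)
    qed
    moreover have "d + t *\<^sub>R y \<in> overlap A B (t *\<^sub>R y)" using t dB by (simp add: overlap_def)
    moreover have "t \<in> {0..<1}" using t by simp
    ultimately have "d + t *\<^sub>R y \<in> (\<lambda>d. (1 - t) *\<^sub>R d + t *\<^sub>R k) ` (A \<inter> B)"
      using hom unfolding homothetic_overlaps_def by blast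
    then obtain z where z: "z \<in> A \<inter> B" "d + t *\<^sub>R y = (1 - t) *\<^sub>R z + t *\<^sub>R k" by blast
    \<comment> \<open>Cancelling \<open>t *\<^sub>R k\<close> exhibits \<open>d\<close>, where
      \<open>u\<close> is largest on \<open>B\<close>, as a combination giving positive weight to
      \<open>l\<close>, where \<open>u\<close> is smallest. Hence \<open>u\<close> is constant on
      \<open>B\<close>, and even the interior point \<open>c\<close> maximizes it.\<close>
    then have "d = (1 - t) *\<^sub>R z + t *\<^sub>R l" by (simp add: y_def algebra_simps)
    then have "inner u d = (1 - t) * inner u z + t * inner u l" by (simp add: inner_add_right)
    also have "\<dots> \<le> (1 - t) * inner u d + t * inner u l"
      using u(2)[of z] z t by (intro add_right_mono mult_left_mono) auto
    finally have "t * inner u d \<le> t * inner u l" by (simp add: algebra_simps)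
    then have ul: "inner u d \<le> inner u l" using t by simp
    have "c \<in> frontier B"
    proof (rule maximum_point_in_frontier[OF u(1)])
      show "c \<in> B" using c interior_subset by auto
      then show "inner u x \<le> inner u c" if "x \<in> B" for x
        using u(2)[OF that] l(2)[of c] ul by linarith
    qed
    with c show False by (simp add: frontier_def)
  qed
qed

lemma homothetic_overlaps_eq:
  fixes A B :: "'a::euclidean_space set"
  assumes "compact A" "convex A" "compact B" "convex B"
    and "interior (A \<inter> B) \<noteq> {}" and "homothetic_overlaps A B"
  shows "A = B"
  using homothetic_overlaps_subset[of A B] homothetic_overlaps_subset[of B A] assms
    homothetic_overlaps_swap[of A B]
  by (auto simp: Int_commute)

section \<open>Homothetic overlaps and simplices\<close>

lemma extreme_point_of_combination:
  assumes "e extreme_point_of K" "x \<in> K" "y \<in> K" "e = (1 - s) *\<^sub>R x + s *\<^sub>R y" "0 < s" "s < 1"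
  shows "x = e" "y = e"
proof -
  have "e \<notin> open_segment x y" using assms by (auto simp: extreme_point_of_def)
  then have "x = y" using assms unfolding in_segment by blast
  with assms show "x = e" "y = e" by (auto simp: algebra_simps)
qed

text \<open>If \<open>f - e = s *\<^sub>R (k - l)\<close> with \<open>s < 1\<close> and
  \<open>k - l\<close> on the frontier, homothety puts \<open>f\<close> strictly between a point of
  \<open>K\<close> and \<open>k\<close>, so \<open>k = f\<close>. Then \<open>e\<close> lies
  strictly between \<open>f\<close> and \<open>l\<close>, so \<open>e = f\<close>.\<close>

lemma extreme_points_difference_frontier:
  fixes K :: "'a::euclidean_space set"
  assumes K: "compact K" "convex K" "interior K \<noteq> {}" and hom: "homothetic_overlaps K K"
    and e: "e extreme_point_of K" and f: "f extreme_point_of K" and "e \<noteq> f"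
  shows "f - e \<in> frontier (difference_body K K)"
proof -
  have eK: "e \<in> K" "f \<in> K" using e f by (auto simp: extreme_point_of_def)
  then have "f - e \<in> difference_body K K" by (auto simp: difference_body_def)
  then obtain s y where sy: "y \<in> frontier (difference_body K K)" "0 \<le> s" "s \<le> 1" "f - e = s *\<^sub>R y"
    using obtain_frontier_multiple[OF compact_difference_body convex_difference_body
        zero_interior_difference_body, OF K(1) K(1) K(2) K(2), of "f - e"] K(3)
    by (metis Int_absorb)
  show ?thesis
  proof (cases "s = 1")
    case True then show ?thesis using sy by simp
  next
    case False
    then have s: "0 < s" "s < 1" using sy \<open>e \<noteq> f\<close> by (auto simp: order_less_le)
    have "closed (difference_body K K)" using K compact_difference_body compact_imp_closed by blast
    then have "y \<in> difference_body K K" using sy(1) frontier_subset_closed by blast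
    then obtain k l where kl: "k \<in> K" "l \<in> K" "y = k - l" by (auto simp: difference_body_def)
    have "k \<in> overlap K K y" using kl by (simp add: overlap_def)
    moreover have "f \<in> overlap K K (s *\<^sub>R y)" using eK by (simp add: overlap_def flip: sy(4))
    moreover have "s \<in> {0..<1}" using s by simp
    ultimately have "f \<in> (\<lambda>d. (1 - s) *\<^sub>R d + s *\<^sub>R k) ` (K \<inter> K)"
      using hom sy(1) unfolding homothetic_overlaps_def by blast
    then obtain m where "m \<in> K" "f = (1 - s) *\<^sub>R m + s *\<^sub>R k" by auto
    then have "k = f" using extreme_point_of_combination[OF f] kl s by blast
    then have "e = (1 - s) *\<^sub>R f + s *\<^sub>R l" using sy(4) kl by (simp add: algebra_simps)
    then have "f = e" using extreme_point_of_combination[OF e] kl s eK by blast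
    with \<open>e \<noteq> f\<close> show ?thesis by simp
  qed
qed

text \<open>Homothety in the frontier direction \<open>f - e\<close> with centre \<open>f\<close>,
  extended to the end value \<open>t = 1\<close>, which \<open>homothetic_overlaps\<close> leaves
  out.\<close>

lemma overlap_extreme_points:
  fixes K :: "'a::euclidean_space set"
  assumes K: "compact K" "convex K" "interior K \<noteq> {}" and hom: "homothetic_overlaps K K"
    and e: "e extreme_point_of K" and f: "f extreme_point_of K" and "e \<noteq> f"
    and k: "k \<in> overlap K K (t *\<^sub>R (f - e))" and t: "0 \<le> t"
  shows "t \<le> 1 \<and> (\<exists>m\<in>K. k = (1 - t) *\<^sub>R m + t *\<^sub>R f)"
proof -
  let ?Q = "difference_body K K"
  note fr = extreme_points_difference_frontier[OF K hom e f \<open>e \<noteq> f\<close>]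
  have eK: "e \<in> K" "f \<in> K" using e f by (auto simp: extreme_point_of_def)
  have fo: "f \<in> overlap K K (f - e)" using eK by (simp add: overlap_def)
  have "t *\<^sub>R (f - e) \<in> ?Q" using k overlap_nonempty_iff by blast
  then have "t *\<^sub>R (f - e) \<in> (*\<^sub>R) 1 ` ?Q" by auto
  then have t1: "t \<le> 1"
    using scale_le_of_frontier_mem[OF convex_difference_body _ fr] zero_interior_difference_body[of K K] K
    by auto
  have hom': "overlap K K (s *\<^sub>R (f - e)) \<subseteq> (\<lambda>d. (1 - s) *\<^sub>R d + s *\<^sub>R p) ` K"
    if "p \<in> overlap K K (f - e)" "0 \<le> s" "s < 1" for s p
    using hom fr that unfolding homothetic_overlaps_def by simp
  show ?thesis
  proof (cases "t = 1")
    case True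
    then have k1: "k \<in> overlap K K (f - e)" using k by simp
    \<comment> \<open>Here the overlap must be the single point \<open>f\<close>. Since
      \<open>f\<close> belongs to the overlap halfway, homothety with centre \<open>k\<close> makes
      \<open>f\<close> the midpoint of \<open>k\<close> and a point of \<open>K\<close>.\<close>
    have "(1 - 1/2) *\<^sub>R f + (1/2) *\<^sub>R f \<in> overlap K K ((1 - 1/2) *\<^sub>R 0 + (1/2::real) *\<^sub>R (f - e))"
      using K fo eK by (intro overlap_combine) auto
    moreover have "(1 - 1/2) *\<^sub>R f + (1/2::real) *\<^sub>R f = f" by (metis diff_add_cancel scaleR_add_left scaleR_one)
    ultimately have "f \<in> overlap K K ((1/2) *\<^sub>R (f - e))" by simp
    then obtain m where "m \<in> K" "f = (1 - 1/2) *\<^sub>R m + (1/2) *\<^sub>R k"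
      using hom'[OF k1, of "1/2"] by auto
    moreover have "k \<in> K" using k by (simp add: overlap_def)
    ultimately have "k = f" using extreme_point_of_combination[OF f, of m k "1/2"] by simp
    then show ?thesis using True eK by auto
  next
    case False
    then show ?thesis using hom'[OF fo, of t] t t1 k by auto
  qed
qed

section \<open>The order of the cone over a convex body\<close>

text \<open>Membership of the pair \<open>(x, h)\<close> in the cone over \<open>K\<close> placed at
  height 1; subtracting a weighted point of \<open>K\<close> subtracts its weight from the
  height.\<close>

definition cone_over :: "'a::real_vector set \<Rightarrow> 'a \<Rightarrow> real \<Rightarrow> bool" where
  "cone_over K x h \<longleftrightarrow> 0 \<le> h \<and> x \<in> (*\<^sub>R) h ` K"

lemma cone_over_scaled: "0 \<le> h \<Longrightarrow> k \<in> K \<Longrightarrow> cone_over K (h *\<^sub>R k) h"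
  by (auto simp: cone_over_def)

lemma cone_over_add:
  assumes "convex K" "cone_over K x h" "cone_over K x' h'"
  shows "cone_over K (x + x') (h + h')"
proof -
  obtain k k' where k: "k \<in> K" "k' \<in> K" "x = h *\<^sub>R k" "x' = h' *\<^sub>R k'" "0 \<le> h" "0 \<le> h'"
    using assms by (auto simp: cone_over_def)
  show ?thesis
  proof (cases "h + h' = 0")
    case True
    then have "h = 0" "h' = 0" using k by auto
    then show ?thesis using k by (auto simp: cone_over_def)
  next
    case False
    then have "h + h' > 0" using k by auto
    then have "(h / (h + h')) *\<^sub>R k + (h' / (h + h')) *\<^sub>R k' \<in> K"
      using k assms(1) by (intro convexD) (auto simp flip: add_divide_distrib)
    from cone_over_scaled[OF _ this, of "h + h'"] \<open>h + h' > 0\<close> show ?thesis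
      using k by (simp add: scaleR_right_distrib)
  qed
qed

lemma cone_over_sum:
  assumes "convex K" "K \<noteq> {}" "finite S" "S \<subseteq> K" "\<And>v. v \<in> S \<Longrightarrow> 0 \<le> u v"
  shows "cone_over K (\<Sum>v\<in>S. u v *\<^sub>R v) (sum u S)"
  using assms(3-5)
proof (induction S rule: finite_induct)
  case empty then show ?case using assms(2) by (auto simp: cone_over_def)
next
  case (insert v S)
  then show ?case using cone_over_add[OF assms(1) cone_over_scaled[of "u v" v K]] by simp
qed

text \<open>In the order of the cone over \<open>K\<close> the next three lemmas say that multiples of distinct extreme
  rays are disjoint, so a common upper bound of two of them dominates their sum.\<close>

lemma cone_over_disjoint_rays:
  fixes K :: "'a::euclidean_space set"
  assumes K: "compact K" "convex K" "interior K \<noteq> {}" and hom: "homothetic_overlaps K K"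
    and e: "e extreme_point_of K" and f: "f extreme_point_of K" and "e \<noteq> f"
    and c: "0 < c" and ze: "cone_over K (z - c *\<^sub>R e) (h - c)" and zf: "cone_over K (z - c *\<^sub>R f) (h - c)"
  shows "cone_over K (z - c *\<^sub>R f - c *\<^sub>R e) (h - c - c)"
proof -
  obtain k l where k: "k \<in> K" "z - c *\<^sub>R e = (h - c) *\<^sub>R k" and l: "l \<in> K" "z - c *\<^sub>R f = (h - c) *\<^sub>R l"
    and hc: "c \<le> h" using ze zf by (auto simp: cone_over_def)
  \<comment> \<open>At height \<open>h = c\<close> both differences vanish, giving
    \<open>c *\<^sub>R e = c *\<^sub>R f\<close>.\<close>
  have "h \<noteq> c" using k l c \<open>e \<noteq> f\<close> by auto
  define r where "r = h - c"
  have r: "r > 0" using hc \<open>h \<noteq> c\<close> by (simp add: r_def)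
  \<comment> \<open>Rescaling by the remaining height \<open>r\<close> turns the two descriptions of
    \<open>z\<close> into a point \<open>k\<close> of the overlap of \<open>K\<close> with its
    translate by \<open>t *\<^sub>R (f - e)\<close>.\<close>
  define t where "t = c / r"
  have "r *\<^sub>R k + c *\<^sub>R e = r *\<^sub>R l + c *\<^sub>R f" unfolding r_def by (simp flip: k(2) l(2))
  then have "r *\<^sub>R l = r *\<^sub>R k - c *\<^sub>R (f - e)" by (simp add: algebra_simps)
  then have "(1 / r) *\<^sub>R (r *\<^sub>R l) = (1 / r) *\<^sub>R (r *\<^sub>R k - c *\<^sub>R (f - e))" by simp
  then have "l = k - t *\<^sub>R (f - e)" using r by (simp add: t_def scaleR_diff_right)
  then have "k \<in> overlap K K (t *\<^sub>R (f - e))" using k l by (simp add: overlap_def)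
  from overlap_extreme_points[OF K hom e f \<open>e \<noteq> f\<close> this] obtain m where
    m: "t \<le> 1" "m \<in> K" "k = (1 - t) *\<^sub>R m + t *\<^sub>R f" using c r by (auto simp: t_def)
  have "r *\<^sub>R k = (r - c) *\<^sub>R m + c *\<^sub>R f"
    using r unfolding m(3) by (simp add: scaleR_right_distrib t_def right_diff_distrib)
  then have "(z - c *\<^sub>R e) - c *\<^sub>R f = (r - c) *\<^sub>R m" unfolding k r_def by simp
  then have "z - c *\<^sub>R f - c *\<^sub>R e = (h - c - c) *\<^sub>R m" by (simp add: r_def algebra_simps)
  moreover have "h - c - c \<ge> 0" using m(1) r by (simp add: t_def r_def field_simps)
  ultimately show ?thesis using cone_over_scaled[of "h - c - c" m K] m by simp
qed

lemma cone_over_disjoint_rays_multiple: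
  fixes K :: "'a::euclidean_space set"
  assumes K: "compact K" "convex K" "interior K \<noteq> {}" and hom: "homothetic_overlaps K K"
    and e: "e extreme_point_of K" and f: "f extreme_point_of K" and "e \<noteq> f" and c: "0 < c"
    and "cone_over K (z - c *\<^sub>R e) (h - c)" and "cone_over K (z - (real m * c) *\<^sub>R f) (h - real m * c)"
  shows "cone_over K (z - (real m * c) *\<^sub>R f - c *\<^sub>R e) (h - real m * c - c)"
  using assms(9,10)
proof (induction m arbitrary: z h)
  case 0 then show ?case by simp
next
  case (Suc m)
  have fK: "f \<in> K" using f by (auto simp: extreme_point_of_def)
  \<comment> \<open>Adding back \<open>m\<close> copies of \<open>c *\<^sub>R f\<close> leaves a
    bound by a single copy, to which the previous lemma applies. The induction then continues from
    \<open>z - c *\<^sub>R f\<close>.\<close>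
  have "cone_over K (z - (real (Suc m) * c) *\<^sub>R f + (real m * c) *\<^sub>R f)
          (h - real (Suc m) * c + real m * c)"
    using c fK by (intro cone_over_add[OF K(2) Suc.prems(2)] cone_over_scaled) auto
  then have "cone_over K (z - c *\<^sub>R f) (h - c)" by (simp add: algebra_simps)
  from cone_over_disjoint_rays[OF K hom e f \<open>e \<noteq> f\<close> c Suc.prems(1) this]
  have "cone_over K (z - c *\<^sub>R f - c *\<^sub>R e) (h - c - c)" .
  moreover have "cone_over K (z - c *\<^sub>R f - (real m * c) *\<^sub>R f) (h - c - real m * c)"
    using Suc.prems(2) by (simp add: algebra_simps)
  ultimately have "cone_over K (z - c *\<^sub>R f - (real m * c) *\<^sub>R f - c *\<^sub>R e) (h - c - real m * c - c)"
    by (rule Suc.IH)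
  then show ?case by (simp add: algebra_simps)
qed

lemma extreme_ray_below_sum:
  fixes K :: "'a::euclidean_space set"
  assumes K: "compact K" "convex K" "interior K \<noteq> {}" and hom: "homothetic_overlaps K K"
    and e: "e extreme_point_of K" and "finite S" and S: "\<And>v. v \<in> S \<Longrightarrow> v extreme_point_of K"
    and u: "\<And>v. v \<in> S \<Longrightarrow> 0 \<le> u v"
    and a: "0 < a" "cone_over K ((\<Sum>v\<in>S. u v *\<^sub>R v) - a *\<^sub>R e) (sum u S - a)"
  shows "e \<in> S"
  using assms(6-)
\<comment> \<open>\<open>a\<close> is generalized because the weight of \<open>e\<close> shrinks to
  \<open>c\<close> in each step.\<close>
proof (induction S arbitrary: a rule: finite_induct)
  case empty then show ?case by (simp add: cone_over_def)
next
  case (insert f S)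
  show ?case
  proof (cases "e = f \<or> u f = 0")
    case True
    then show ?thesis
    proof
      assume "u f = 0"
      then show ?thesis using insert.prems insert.hyps insert.IH[OF _ _ insert.prems(3)] by simp
    qed simp
  next
    case False
    then have uf: "u f > 0" "e \<noteq> f" using insert.prems(2)[of f] by auto
    have f: "f extreme_point_of K" using insert.prems(1) by simp
    have eK: "e \<in> K" and SK: "S \<subseteq> K" using e insert.prems(1) by (auto simp: extreme_point_of_def)
    \<comment> \<open>The disjointness lemma needs equal weights on both rays, so \<open>u f\<close>
      is cut into \<open>m\<close> equal pieces \<open>c\<close>, small enough that
      \<open>c \<le> a\<close>.\<close>
    obtain m where m: "u f / a < real m" using reals_Archimedean2 by blast
    then have m0: "real m > 0" using uf insert.prems(3) by (meson divide_pos_pos less_trans)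
    define c where "c = u f / real m"
    have c: "c > 0" "c \<le> a" "real m * c = u f"
      using uf m m0 insert.prems(3) by (auto simp: c_def field_simps)
    define z h where "z = (\<Sum>v\<in>insert f S. u v *\<^sub>R v)" and "h = sum u (insert f S)"
    have zh: "z - u f *\<^sub>R f = (\<Sum>v\<in>S. u v *\<^sub>R v)" "h - u f = sum u S"
      using insert.hyps by (simp_all add: z_def h_def)
    have "cone_over K (z - a *\<^sub>R e + (a - c) *\<^sub>R e) (h - a + (a - c))"
      using insert.prems(4) c eK unfolding z_def h_def by (intro cone_over_add[OF K(2)] cone_over_scaled) auto
    then have "cone_over K (z - c *\<^sub>R e) (h - c)" by (simp add: algebra_simps)
    moreover have "cone_over K (z - (real m * c) *\<^sub>R f) (h - real m * c)"
      unfolding c zh using K(2) SK insert.hyps(1) insert.prems(2) eK by (intro cone_over_sum) auto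
    ultimately have "cone_over K (z - (real m * c) *\<^sub>R f - c *\<^sub>R e) (h - real m * c - c)"
      by (rule cone_over_disjoint_rays_multiple[OF K hom e f uf(2) c(1)])
    then have "e \<in> S"
      unfolding c zh using insert.IH[OF _ _ c(1)] insert.prems by auto
    then show ?thesis by simp
  qed
qed

text \<open>In an affine dependence, moving the negative coefficients to the other side puts a
  positive multiple of an extreme point \<open>e\<close> below a combination of extreme points other
  than \<open>e\<close>, against \<open>extreme_ray_below_sum\<close>.\<close>

lemma affine_independent_extreme_points:
  fixes K :: "'a::euclidean_space set"
  assumes K: "compact K" "convex K" "interior K \<noteq> {}" and hom: "homothetic_overlaps K K"
  shows "\<not> affine_dependent {x. x extreme_point_of K}"
proof
  assume "affine_dependent {x. x extreme_point_of K}"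
  then obtain S U where S: "finite S" "S \<subseteq> {x. x extreme_point_of K}" and U: "sum U S = 0"
    "\<exists>v\<in>S. U v \<noteq> 0" "(\<Sum>v\<in>S. U v *\<^sub>R v) = 0"
    unfolding affine_dependent_explicit by blast
  obtain e where e: "e \<in> S" "U e > 0"
  proof (rule ccontr)
    assume "\<not> thesis"
    then have "\<forall>v\<in>S. 0 \<le> - U v" using that by (meson neg_0_le_iff_le not_le)
    moreover have "(\<Sum>v\<in>S. - U v) = 0" using U(1) by (simp add: sum_negf)
    ultimately have "\<forall>v\<in>S. - U v = 0" using sum_nonneg_eq_0_iff[OF S(1), of "\<lambda>v. - U v"] by blast
    with U(2) show False by simp
  qed
  define N P where "N = {v \<in> S. U v < 0}" and "P = {v \<in> S. U v \<ge> 0} - {e}"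
  have fin: "finite N" "finite P" using S(1) by (auto simp: N_def P_def)
  have SNP: "S = insert e (N \<union> P)" "N \<inter> P = {}" "e \<notin> N \<union> P" using e by (auto simp: N_def P_def)
  have "sum (\<lambda>v. - U v) N - U e = sum U P"
    using U(1) unfolding SNP(1) using fin SNP by (simp add: sum.union_disjoint sum_negf)
  moreover have "(\<Sum>v\<in>N. (- U v) *\<^sub>R v) - U e *\<^sub>R e = (\<Sum>v\<in>P. U v *\<^sub>R v)"
    using U(3) unfolding SNP(1) using fin SNP
    by (simp add: sum.union_disjoint sum_negf eq_diff_eq diff_eq_eq neg_eq_iff_add_eq_0 add.assoc)
      (simp add: algebra_simps add_eq_0_iff)
  moreover have "cone_over K (\<Sum>v\<in>P. U v *\<^sub>R v) (sum U P)"
    using fin S K interior_empty by (intro cone_over_sum) (auto simp: P_def extreme_point_of_def)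
  ultimately have "cone_over K ((\<Sum>v\<in>N. (- U v) *\<^sub>R v) - U e *\<^sub>R e) (sum (\<lambda>v. - U v) N - U e)" by simp
  then have "e \<in> N"
    using extreme_ray_below_sum[OF K hom _ fin(1) _ _ e(2), of e "\<lambda>v. - U v"] S e by (auto simp: N_def)
  then show False using e by (simp add: N_def)
qed

text \<open>\<open>K\<close> is the hull of its extreme points, and full dimension fixes the number
  of these affinely independent points.\<close>

lemma simplex_of_homothetic_overlaps:
  fixes K :: "'a::euclidean_space set"
  assumes K: "compact K" "convex K" "interior K \<noteq> {}" and hom: "homothetic_overlaps K K"
  shows "int DIM('a) simplex K"
proof -
  let ?E = "{x. x extreme_point_of K}"
  have ind: "\<not> affine_dependent ?E" by (rule affine_independent_extreme_points[OF assms])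
  have hull: "K = convex hull ?E" by (rule Krein_Milman_Minkowski[OF K(1,2)])
  have "int (card ?E) - 1 = aff_dim ?E" using aff_dim_affine_independent[OF ind] by simp
  also have "\<dots> = aff_dim K" by (metis hull aff_dim_convex_hull)
  also have "\<dots> = int DIM('a)" using K(3) by (rule aff_dim_nonempty_interior)
  finally show ?thesis unfolding simplex_def using ind hull by (intro exI[of _ ?E]) auto
qed

text \<open>By uniqueness of barycentric coordinates, those of \<open>z\<close> and
  \<open>z - x\<close> differ by the coordinates of \<open>x\<close>. So the coordinates of
  \<open>z\<close> dominate their positive part \<open>P\<close>, and removing \<open>P\<close>
  leaves total weight \<open>1 - l\<close>.\<close>

lemma simplex_overlap_subset:
  fixes K :: "'a::euclidean_space set"
  assumes "m simplex K" "x \<in> difference_body K K"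
  obtains l w where "0 \<le> l" "l \<le> 1" "x \<in> (*\<^sub>R) l ` difference_body K K"
    "overlap K K x \<subseteq> (\<lambda>k. w + (1 - l) *\<^sub>R k) ` K"
proof -
  obtain C where C: "finite C" "\<not> affine_dependent C" "K = convex hull C"
    using assms(1) unfolding simplex by blast
  have K: "convex K" "C \<subseteq> K" unfolding C(3) by (auto simp: hull_inc)
  obtain p q where pq: "p \<in> K" "q \<in> K" "x = p - q" using assms(2) by (auto simp: difference_body_def)
  have K0: "K \<noteq> {}" using pq by auto
  obtain \<alpha> where \<alpha>: "\<forall>v\<in>C. 0 \<le> \<alpha> v" "sum \<alpha> C = 1" "(\<Sum>v\<in>C. \<alpha> v *\<^sub>R v) = p"
    using pq(1) unfolding C(3) convex_hull_finite[OF C(1)] by auto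
  obtain \<beta> where \<beta>: "\<forall>v\<in>C. 0 \<le> \<beta> v" "sum \<beta> C = 1" "(\<Sum>v\<in>C. \<beta> v *\<^sub>R v) = q"
    using pq(2) unfolding C(3) convex_hull_finite[OF C(1)] by auto
  \<comment> \<open>Positive and negative parts of the coordinates of \<open>x\<close>. They have
    equal sums \<open>l\<close>, because \<alpha> and \<beta> both sum to 1; hence \<open>x\<close>
    is \<open>l\<close> times a difference of points of \<open>K\<close>.\<close>
  define P N where "P v = max 0 (\<alpha> v - \<beta> v)" and "N v = max 0 (\<beta> v - \<alpha> v)" for v
  have PN: "P v - N v = \<alpha> v - \<beta> v" "0 \<le> P v" "0 \<le> N v" for v by (auto simp: P_def N_def)
  define l where "l = sum P C"
  have "sum P C - sum N C = 0" unfolding sum_subtractf[symmetric] PN by (simp add: sum_subtractf \<alpha> \<beta>)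
  then have lN: "l = sum N C" by (simp add: l_def)
  have "cone_over K (\<Sum>v\<in>C. P v *\<^sub>R v) l" "cone_over K (\<Sum>v\<in>C. N v *\<^sub>R v) l"
    unfolding l_def using lN[unfolded l_def] cone_over_sum[OF K(1) K0 C(1) K(2)] PN by metis+
  then obtain k k' where k: "k \<in> K" "k' \<in> K" "(\<Sum>v\<in>C. P v *\<^sub>R v) = l *\<^sub>R k" "(\<Sum>v\<in>C. N v *\<^sub>R v) = l *\<^sub>R k'"
    by (auto simp: cone_over_def)
  have "x = (\<Sum>v\<in>C. (P v - N v) *\<^sub>R v)"
    unfolding PN pq using \<alpha> \<beta> by (simp add: scaleR_diff_left sum_subtractf)
  also have "\<dots> = l *\<^sub>R (k - k')" using k by (simp add: scaleR_diff_left sum_subtractf scaleR_diff_right)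
  finally have "x \<in> (*\<^sub>R) l ` difference_body K K" using k by (auto simp: difference_body_def)
  moreover have "0 \<le> l" unfolding l_def by (intro sum_nonneg PN)
  moreover have "l \<le> 1" unfolding l_def \<alpha>(2)[symmetric] using \<alpha>(1) \<beta>(1) by (intro sum_mono) (auto simp: P_def)
  moreover have "overlap K K x \<subseteq> (\<lambda>k. (\<Sum>v\<in>C. P v *\<^sub>R v) + (1 - l) *\<^sub>R k) ` K"
  proof
    fix z assume "z \<in> overlap K K x"
    then have z: "z \<in> K" "z - x \<in> K" by (auto simp: overlap_def)
    obtain \<gamma> where \<gamma>: "\<forall>v\<in>C. 0 \<le> \<gamma> v" "sum \<gamma> C = 1" "(\<Sum>v\<in>C. \<gamma> v *\<^sub>R v) = z"
      using z(1) unfolding C(3) convex_hull_finite[OF C(1)] by auto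
    obtain \<delta> where \<delta>: "\<forall>v\<in>C. 0 \<le> \<delta> v" "sum \<delta> C = 1" "(\<Sum>v\<in>C. \<delta> v *\<^sub>R v) = z - x"
      using z(2) unfolding C(3) convex_hull_finite[OF C(1)] by auto
    define U where "U v = \<gamma> v - \<delta> v - (\<alpha> v - \<beta> v)" for v
    have "sum U C = 0" by (simp add: U_def sum_subtractf \<alpha> \<beta> \<gamma> \<delta>)
    moreover have "(\<Sum>v\<in>C. U v *\<^sub>R v) = 0"
      by (simp add: U_def sum_subtractf scaleR_diff_left \<alpha> \<beta> \<gamma> \<delta> pq)
    ultimately have U: "\<forall>v\<in>C. U v = 0" using C(2) unfolding affine_dependent_explicit_finite[OF C(1)] by blast
    have "0 \<le> \<gamma> v - P v" if "v \<in> C" for v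
      using U \<gamma>(1) \<delta>(1) that by (fastforce simp: U_def P_def)
    then have "cone_over K (\<Sum>v\<in>C. (\<gamma> v - P v) *\<^sub>R v) (sum (\<lambda>v. \<gamma> v - P v) C)"
      by (intro cone_over_sum[OF K(1) K0 C(1) K(2)])
    then have "cone_over K (z - (\<Sum>v\<in>C. P v *\<^sub>R v)) (1 - l)"
      by (simp add: sum_subtractf scaleR_diff_left \<gamma> l_def)
    then obtain y where "y \<in> K" "z - (\<Sum>v\<in>C. P v *\<^sub>R v) = (1 - l) *\<^sub>R y" by (auto simp: cone_over_def)
    then show "z \<in> (\<lambda>k. (\<Sum>v\<in>C. P v *\<^sub>R v) + (1 - l) *\<^sub>R k) ` K"
      by (intro image_eqI[of _ _ y]) (auto simp: algebra_simps)
  qed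
  ultimately show thesis using that by blast
qed

section \<open>Volumes of overlaps\<close>

text \<open>Connects the volumes, taken with \<open>lebesgue\<close>, to the integrals, which are
  taken over \<open>lborel\<close> so that Fubini applies.\<close>

lemma emeasure_compact_eq_measure_lebesgue:
  fixes S :: "'a::euclidean_space set"
  assumes "compact S"
  shows "emeasure lborel S = ennreal (measure lebesgue S)"
proof -
  have "emeasure lborel S = ennreal (measure lborel S)"
    using emeasure_compact_finite[OF assms] by (intro emeasure_eq_ennreal_measure) auto
  then show ?thesis using assms by (simp add: measure_completion borel_compact)
qed

lemma measure_lebesgue_homothety:
  fixes S :: "'a::euclidean_space set"
  assumes "0 \<le> r"
  shows "measure lebesgue ((\<lambda>x. r *\<^sub>R x + v) ` S) = r ^ DIM('a) * measure lebesgue S"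
  using measure_lebesgue_affine[of r v S] assms by simp

lemma measure_lebesgue_interior_pos:
  fixes S :: "'a::euclidean_space set"
  assumes "compact S" "interior S \<noteq> {}"
  shows "0 < measure lebesgue S"
proof -
  have "\<not> negligible S"
    using assms(2) open_not_negligible[of "interior S"] interior_subset negligible_subset by blast
  then show ?thesis
    using negligible_iff_measure0[OF lmeasurable_compact[OF assms(1)]]
    by (simp add: order_less_le)
qed

text \<open>A point of \<open>Y\<close> outside the closed set \<open>X\<close> is a limit of
  interior points of \<open>Y\<close>, so \<open>Y\<close> exceeds \<open>X\<close> by a nonempty
  open set, which has positive volume.\<close>

lemma convex_subset_of_measure_le:
  fixes X Y :: "'a::euclidean_space set"
  assumes X: "compact X" and Y: "compact Y" "convex Y" "interior Y \<noteq> {}"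
    and sub: "X \<subseteq> Y" and le: "measure lebesgue Y \<le> measure lebesgue X"
  shows "Y \<subseteq> X"
proof (rule ccontr)
  assume "\<not> Y \<subseteq> X"
  then obtain y where y: "y \<in> Y" "y \<in> - X" by auto
  have "y \<in> closure (interior Y)" using convex_closure_interior[OF Y(2,3)] y closure_subset by auto
  moreover have "open (- X)" using X compact_imp_closed by auto
  ultimately have ne: "interior Y \<inter> - X \<noteq> {}" (is "?U \<noteq> {}")
    using y(2) open_Int_closure_eq_empty[of "- X" "interior Y"] by blast
  have "open ?U" using \<open>open (- X)\<close> by auto
  have "bounded ?U" using Y(1) interior_subset by (meson bounded_Int bounded_subset compact_imp_bounded)
  then have U: "?U \<in> lmeasurable" using \<open>open ?U\<close> lmeasurable_open by blast
  have "measure lebesgue ?U > 0"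
    using negligible_iff_measure0[OF U] open_not_negligible[OF \<open>open ?U\<close> ne] by (simp add: order_less_le)
  moreover have "measure lebesgue (X \<union> ?U) = measure lebesgue X + measure lebesgue ?U"
    using lmeasurable_compact[OF X] U by (intro measure_Un_AE AE_I2) auto
  moreover have "measure lebesgue (X \<union> ?U) \<le> measure lebesgue Y"
    using sub interior_subset[of Y] lmeasurable_compact[OF Y(1)] lmeasurable_compact[OF X] U
    by (intro measure_mono_fmeasurable) auto
  ultimately show False using le by linarith
qed

lemma compact_overlap:
  fixes A B :: "'a::real_normed_vector set"
  assumes "compact A" "compact B"
  shows "compact (overlap A B x)"
proof -
  have "overlap A B x = A \<inter> (+) x ` B"
    by (force simp: overlap_def image_iff intro: bexI[of _ "_ - x"])
  then show ?thesis using assms compact_Int compact_translation by metis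
qed

lemma convex_overlap:
  assumes "convex A" "convex B"
  shows "convex (overlap A B x)"
proof (rule convexI)
  fix z w and u v :: real assume zw: "z \<in> overlap A B x" "w \<in> overlap A B x" "0 \<le> u" "0 \<le> v" "u + v = 1"
  then have u: "u = 1 - v" by simp
  have "(1 - v) *\<^sub>R x + v *\<^sub>R x = x" by (simp flip: scaleR_left_distrib)
  then show "u *\<^sub>R z + v *\<^sub>R w \<in> overlap A B x"
    using overlap_combine[OF assms, of v z x w x] zw unfolding u by simp
qed

text \<open>A homothety of ratio \<open>1 - t\<close> towards a point of the overlap at
  \<open>y\<close> maps one overlap into the other. The inequality uses \<open>x = 0\<close>; the
  equality case uses other \<open>x\<close> too.\<close>

lemma measure_overlap_ge:
  fixes A B :: "'a::euclidean_space set"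
  assumes A: "compact A" "convex A" and B: "compact B" "convex B"
    and y: "y \<in> difference_body A B" and t: "0 \<le> t" "t \<le> 1"
  shows "(1 - t) ^ DIM('a) * measure lebesgue (overlap A B x)
           \<le> measure lebesgue (overlap A B ((1 - t) *\<^sub>R x + t *\<^sub>R y))"
proof -
  obtain p where p: "p \<in> overlap A B y" using y overlap_nonempty_iff by blast
  let ?h = "\<lambda>z. (1 - t) *\<^sub>R z + t *\<^sub>R p"
  have "?h ` overlap A B x \<subseteq> overlap A B ((1 - t) *\<^sub>R x + t *\<^sub>R y)"
    using overlap_combine[OF A(2) B(2) t _ p] by auto
  moreover have "compact (?h ` overlap A B x)"
    by (intro compact_continuous_image compact_overlap continuous_intros A B)
  ultimately have "measure lebesgue (?h ` overlap A B x) \<le> measure lebesgue (overlap A B ((1 - t) *\<^sub>R x + t *\<^sub>R y))"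
    using lmeasurable_compact compact_overlap A B by (intro measure_mono_fmeasurable) blast+
  then show ?thesis using measure_lebesgue_homothety[of "1 - t" "t *\<^sub>R p" "overlap A B x"] t by simp
qed

text \<open>The overlap volume is the convolution of the indicators of \<open>A\<close> and of the
  reflection of \<open>B\<close>, so Fubini factors its integral.\<close>

lemma nn_integral_measure_overlap:
  fixes A B :: "'a::euclidean_space set"
  assumes "compact A" "compact B"
  shows "(\<integral>\<^sup>+x. ennreal (measure lebesgue (overlap A B x)) \<partial>lborel) = ennreal (measure lebesgue A * measure lebesgue B)"
proof -
  have [measurable]: "A \<in> sets borel" "B \<in> sets borel" using assms borel_compact by auto
  have "(\<integral>\<^sup>+x. ennreal (measure lebesgue (overlap A B x)) \<partial>lborel)
      = (\<integral>\<^sup>+x. (\<integral>\<^sup>+z. indicator A z * indicator B (z - x) \<partial>lborel) \<partial>lborel)"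
  proof (intro nn_integral_cong)
    fix x
    have "ennreal (measure lebesgue (overlap A B x)) = (\<integral>\<^sup>+z. indicator (overlap A B x) z \<partial>lborel)"
      using emeasure_compact_eq_measure_lebesgue[OF compact_overlap[OF assms]]
        borel_compact[OF compact_overlap[OF assms]] by simp
    also have "\<dots> = (\<integral>\<^sup>+z. indicator A z * indicator B (z - x) \<partial>lborel)"
      by (intro nn_integral_cong) (auto simp: overlap_def indicator_def)
    finally show "ennreal (measure lebesgue (overlap A B x)) = \<dots>" .
  qed
  also have "\<dots> = (\<integral>\<^sup>+z. (\<integral>\<^sup>+x. indicator A z * indicator B (z - x) \<partial>lborel) \<partial>lborel)"
    by (rule lborel_pair.Fubini') measurable
  also have "\<dots> = (\<integral>\<^sup>+z. ennreal (measure lebesgue B) * indicator A z \<partial>lborel)"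
  proof (intro nn_integral_cong)
    fix z
    let ?R = "(\<lambda>b. (-1) *\<^sub>R b + z) ` B"
    have R: "compact ?R" using assms by (intro compact_continuous_image continuous_intros)
    have "indicator B (z - x) = (indicator ?R x :: ennreal)" for x
      by (force simp: indicator_def image_iff intro: bexI[of _ "z - x"])
    then have "(\<integral>\<^sup>+x. indicator B (z - x) \<partial>lborel) = emeasure lborel ?R" using borel_compact[OF R] by simp
    also have "\<dots> = ennreal (measure lebesgue B)"
      unfolding emeasure_compact_eq_measure_lebesgue[OF R] measure_lebesgue_affine by simp
    finally show "(\<integral>\<^sup>+x. indicator A z * indicator B (z - x) \<partial>lborel) = ennreal (measure lebesgue B) * indicator A z"
      by (subst nn_integral_cmult) (auto simp: mult.commute)
  qed
  also have "\<dots> = ennreal (measure lebesgue A * measure lebesgue B)"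
    by (subst nn_integral_cmult_indicator)
      (auto simp: emeasure_compact_eq_measure_lebesgue[OF assms(1)] mult.commute simp flip: ennreal_mult)
  finally show ?thesis .
qed

section \<open>The conical profile and its integral\<close>

definition scaled_copies :: "'a::real_vector set \<Rightarrow> ('a \<times> real) set" where
  "scaled_copies Q = {(x, t). 0 \<le> t \<and> t \<le> 1 \<and> x \<in> (*\<^sub>R) t ` Q}"

text \<open>With \<open>g\<close> the gauge of \<open>Q\<close>, this is \<open>(1 - g x) ^ n\<close> on \<open>Q\<close> and \<open>0\<close> elsewhere; the integral
  form makes its integral over the space accessible to Fubini.\<close>

definition conical_profile :: "'a::euclidean_space set \<Rightarrow> 'a \<Rightarrow> ennreal" where
  "conical_profile Q x = (\<integral>\<^sup>+t. ennreal (real DIM('a) * (1 - t) ^ (DIM('a) - 1)) * indicator (scaled_copies Q) (x, t) \<partial>lborel)"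

lemma compact_scaled_copies:
  fixes Q :: "'a::real_normed_vector set"
  assumes "compact Q" shows "compact (scaled_copies Q)"
proof -
  have "scaled_copies Q = (\<lambda>(t, q). (t *\<^sub>R q, t)) ` ({0..1} \<times> Q)"
    by (auto simp: scaled_copies_def image_iff)
  moreover have "compact \<dots>" unfolding case_prod_unfold
    by (intro compact_continuous_image compact_Times assms compact_Icc continuous_intros)
  ultimately show ?thesis by simp
qed

text \<open>The heights \<open>s\<close> at which \<open>s\<close>-scaled \<open>Q\<close> contains
  \<open>t *\<^sub>R y\<close> form the interval from \<open>t\<close> to 1, and the weight has
  antiderivative \<open>- ((1 - s) ^ n)\<close> for \<open>n\<close> the dimension.\<close>

lemma conical_profile_frontier:
  fixes Q :: "'a::euclidean_space set"
  assumes Q: "compact Q" "convex Q" "0 \<in> interior Q" and y: "y \<in> frontier Q" and t: "0 \<le> t" "t \<le> 1"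
  shows "conical_profile Q (t *\<^sub>R y) = ennreal ((1 - t) ^ DIM('a))"
proof -
  let ?n = "DIM('a)"
  have yQ: "y \<in> Q" using Q(1) y compact_imp_closed frontier_subset_closed by blast
  have Q0: "0 \<in> Q" using Q(3) interior_subset by auto
  have "(t *\<^sub>R y, s) \<in> scaled_copies Q \<longleftrightarrow> s \<in> {t..1}" for s
  proof
    assume "(t *\<^sub>R y, s) \<in> scaled_copies Q"
    then show "s \<in> {t..1}"
      using scale_le_of_frontier_mem[OF Q(2,3) y, of s t] by (auto simp: scaled_copies_def)
  next
    assume s: "s \<in> {t..1}"
    have "t *\<^sub>R y \<in> (*\<^sub>R) s ` Q"
    proof (cases "s = 0")
      case True then show ?thesis using s t Q0 by auto
    next
      case False
      then have "(1 - t / s) *\<^sub>R 0 + (t / s) *\<^sub>R y \<in> Q"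
        using s t Q0 yQ by (intro convexD[OF Q(2)]) auto
      then show ?thesis using False by (intro image_eqI[of _ _ "(t / s) *\<^sub>R y"]) auto
    qed
    then show "(t *\<^sub>R y, s) \<in> scaled_copies Q" using s t by (auto simp: scaled_copies_def)
  qed
  then have "conical_profile Q (t *\<^sub>R y)
      = (\<integral>\<^sup>+s. ennreal (real ?n * (1 - s) ^ (?n - 1)) * indicator {t..1} s \<partial>lborel)"
    unfolding conical_profile_def by (intro nn_integral_cong) (auto simp: indicator_def)
  also have "\<dots> = ennreal (- ((1 - 1) ^ ?n) - (- ((1 - t) ^ ?n)))"
    using t by (intro nn_integral_FTC_Icc) (auto intro!: derivative_eq_intros)
  finally show ?thesis by (simp add: power_0_left)
qed

lemma conical_profile_ge:
  fixes Q :: "'a::euclidean_space set"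
  assumes Q: "compact Q" "convex Q" "0 \<in> interior Q" and t: "0 \<le> t" "t \<le> 1" and x: "x \<in> (*\<^sub>R) t ` Q"
  shows "ennreal ((1 - t) ^ DIM('a)) \<le> conical_profile Q x"
proof -
  obtain q where q: "q \<in> Q" "x = t *\<^sub>R q" using x by auto
  obtain s y where sy: "y \<in> frontier Q" "0 \<le> s" "s \<le> 1" "q = s *\<^sub>R y"
    using obtain_frontier_multiple[OF Q q(1)] by blast
  have "conical_profile Q ((t * s) *\<^sub>R y) = ennreal ((1 - t * s) ^ DIM('a))"
    using sy t by (intro conical_profile_frontier[OF Q]) (auto intro: mult_le_one)
  moreover have "t * s \<le> t" using sy t by (simp add: mult_left_le)
  ultimately show ?thesis using q sy t by (auto intro!: ennreal_leI power_mono)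
qed

lemma conical_profile_outside:
  fixes Q :: "'a::euclidean_space set"
  assumes "convex Q" "0 \<in> Q" "x \<notin> Q"
  shows "conical_profile Q x = 0"
proof -
  have "(x, t) \<notin> scaled_copies Q" for t
  proof
    assume "(x, t) \<in> scaled_copies Q"
    then obtain q where "q \<in> Q" "x = (1 - t) *\<^sub>R 0 + t *\<^sub>R q" "0 \<le> t" "t \<le> 1" by (auto simp: scaled_copies_def)
    then have "x \<in> Q" using convexD[OF assms(1,2), of q "1 - t" t] by auto
    with assms(3) show False by simp
  qed
  then show ?thesis by (simp add: conical_profile_def)
qed

text \<open>The integral is \<open>n\<close> times the Beta value at \<open>n + 1\<close> and
  \<open>n\<close>, that is, \<open>n\<close> factorial squared over \<open>2 * n\<close>
  factorial.\<close>

lemma nn_integral_beta_binomial: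
  assumes "n > 0"
  shows "(\<integral>\<^sup>+t. ennreal (real n * (1 - t) ^ (n - 1) * t ^ n) * indicator {0..1} t \<partial>lborel)
           = ennreal (1 / real ((2 * n) choose n))"
proof -
  have "((\<lambda>t. t powr (real (Suc n) - 1) * (1 - t) powr (real n - 1)) has_integral Beta (real (Suc n)) (real n)) {0..1}"
    using assms by (intro has_integral_Beta_real) auto
  then have "((\<lambda>t. (1 - t) ^ (n - 1) * t ^ n) has_integral Beta (real (Suc n)) (real n)) {0..1}"
  \<comment> \<open>The endpoints are discarded because \<open>0 powr 0\<close> is 0 while
    \<open>0 ^ 0\<close> is 1, which matters for \<open>n = 1\<close>.\<close>
  proof (rule has_integral_spike_finite[of "{0, 1}", rotated 2])
    fix t :: real assume "t \<in> {0..1} - {0, 1}"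
    then have "0 < t" "t < 1" by auto
    then show "(1 - t) ^ (n - 1) * t ^ n = t powr (real (Suc n) - 1) * (1 - t) powr (real n - 1)"
      using assms powr_realpow[of t n] powr_realpow[of "1 - t" "n - 1"] by (simp add: of_nat_diff)
  qed simp
  then have "((\<lambda>t. real n * ((1 - t) ^ (n - 1) * t ^ n)) has_integral real n * Beta (real (Suc n)) (real n)) {0..1}"
    by (rule has_integral_mult_right)
  then have "(\<integral>\<^sup>+t. ennreal (real n * ((1 - t) ^ (n - 1) * t ^ n)) * indicator {0..1} t \<partial>lborel)
      = ennreal (real n * Beta (real (Suc n)) (real n))"
    by (intro nn_integral_has_integral_lebesgue') auto
  moreover have "real n * Beta (real (Suc n)) (real n) = 1 / real ((2 * n) choose n)"
  proof -
    obtain m where m: "n = Suc m" using assms gr0_implies_Suc by blast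
    have 1: "Gamma (real (Suc n)) = fact n" "Gamma (real n) = fact m"
      "Gamma (real (Suc n) + real n) = fact (2 * n)"
      using Gamma_fact[of n, where 'a = real] Gamma_fact[of m, where 'a = real]
        Gamma_fact[of "2 * n", where 'a = real] by (simp_all add: m algebra_simps)
    have 2: "real n * fact m = fact n" by (simp add: m)
    have "real n * Beta (real (Suc n)) (real n) = fact n * (real n * fact m) / fact (2 * n)"
      unfolding Beta_def 1 by simp
    also have "\<dots> = fact n * fact n / fact (2 * n)" unfolding 2 ..
    also have "\<dots> = 1 / real ((2 * n) choose n)"
      using binomial_fact[of n "2 * n", where 'a = real] by (simp add: mult_2)
    finally show ?thesis .
  qed
  ultimately show ?thesis by (simp add: mult.assoc)
qed

lemma scaled_copies_measurable:
  fixes Q :: "'a::euclidean_space set"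
  assumes "compact Q"
  shows "scaled_copies Q \<in> sets (borel \<Otimes>\<^sub>M borel)"
  unfolding borel_prod by (rule borel_compact[OF compact_scaled_copies[OF assms]])

lemma borel_measurable_conical_profile:
  fixes Q :: "'a::euclidean_space set"
  assumes "compact Q"
  shows "(\<lambda>x. conical_profile Q x) \<in> borel_measurable lborel"
proof -
  note scaled_copies_measurable[OF assms, measurable]
  show ?thesis unfolding conical_profile_def by measurable
qed

text \<open>Fubini integrates over slices first: the slice at height \<open>t\<close> is a copy of
  \<open>Q\<close> scaled by \<open>t\<close>, which contributes the factor \<open>t ^ n\<close> of
  the Beta integral.\<close>

lemma nn_integral_conical_profile:
  fixes Q :: "'a::euclidean_space set"
  assumes "compact Q"
  shows "(\<integral>\<^sup>+x. conical_profile Q x \<partial>lborel) = ennreal (measure lebesgue Q / real ((2 * DIM('a)) choose DIM('a)))"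
proof -
  let ?n = "DIM('a)"
  note scaled_copies_measurable[OF assms, measurable]
  have "(\<integral>\<^sup>+x. conical_profile Q x \<partial>lborel)
     = (\<integral>\<^sup>+t. (\<integral>\<^sup>+x. ennreal (real ?n * (1 - t) ^ (?n - 1)) * indicator (scaled_copies Q) (x, t) \<partial>lborel) \<partial>lborel)"
    unfolding conical_profile_def by (rule lborel_pair.Fubini'[symmetric]) measurable
  also have "\<dots> = (\<integral>\<^sup>+t. ennreal (measure lebesgue Q) * (ennreal (real ?n * (1 - t) ^ (?n - 1) * t ^ ?n) * indicator {0..1} t) \<partial>lborel)"
  proof (intro nn_integral_cong)
    fix t :: real
    show "(\<integral>\<^sup>+x. ennreal (real ?n * (1 - t) ^ (?n - 1)) * indicator (scaled_copies Q) (x, t) \<partial>lborel)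
        = ennreal (measure lebesgue Q) * (ennreal (real ?n * (1 - t) ^ (?n - 1) * t ^ ?n) * indicator {0..1} t)"
    proof (cases "t \<in> {0..1}")
      case True
      let ?tQ = "(\<lambda>x. t *\<^sub>R x + 0) ` Q"
      have tQ: "compact ?tQ" using assms by (intro compact_continuous_image continuous_intros)
      have "indicator (scaled_copies Q) (x, t) = (indicator ?tQ x :: ennreal)" for x
        using True by (auto simp: scaled_copies_def indicator_def)
      then have "(\<integral>\<^sup>+x. ennreal (real ?n * (1 - t) ^ (?n - 1)) * indicator (scaled_copies Q) (x, t) \<partial>lborel)
          = ennreal (real ?n * (1 - t) ^ (?n - 1)) * ennreal (measure lebesgue ?tQ)"
        using borel_compact[OF tQ] emeasure_compact_eq_measure_lebesgue[OF tQ] by (simp add: nn_integral_cmult_indicator)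
      also have "\<dots> = ennreal (measure lebesgue Q) * ennreal (real ?n * (1 - t) ^ (?n - 1) * t ^ ?n)"
      proof -
        have "0 \<le> t" "t \<le> 1" using True by auto
        then show ?thesis
          unfolding measure_lebesgue_homothety[OF \<open>0 \<le> t\<close>]
          by (subst (1 2) ennreal_mult[symmetric]) (auto simp: mult_ac)
      qed
      finally show ?thesis using True by simp
    qed (auto simp: scaled_copies_def indicator_def)
  qed
  also have "\<dots> = ennreal (measure lebesgue Q) * ennreal (1 / real ((2 * ?n) choose ?n))"
    by (subst nn_integral_cmult) (simp_all add: nn_integral_beta_binomial[OF DIM_positive] del: One_nat_def)
  finally show ?thesis by (simp flip: ennreal_mult)
qed

section \<open>The inequality and its equality case\<close>

lemma conical_profile_le_measure_overlap:
  fixes A B :: "'a::euclidean_space set"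
  assumes A: "compact A" "convex A" and B: "compact B" "convex B" and int: "interior (A \<inter> B) \<noteq> {}"
  shows "ennreal (measure lebesgue (A \<inter> B)) * conical_profile (difference_body A B) x
           \<le> ennreal (measure lebesgue (overlap A B x))"
proof -
  let ?Q = "difference_body A B"
  have Q: "compact ?Q" "convex ?Q" "0 \<in> interior ?Q"
    using difference_body_convex_body[OF assms] by auto
  show ?thesis
  proof (cases "x \<in> ?Q")
    case True
    then obtain t y where ty: "y \<in> frontier ?Q" "0 \<le> t" "t \<le> 1" "x = t *\<^sub>R y"
      using obtain_frontier_multiple[OF Q] by blast
    have "y \<in> ?Q" using ty(1) Q(1) compact_imp_closed frontier_subset_closed by blast
    then have "(1 - t) ^ DIM('a) * measure lebesgue (A \<inter> B) \<le> measure lebesgue (overlap A B x)"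
      using measure_overlap_ge[OF A B _ ty(2,3), of y 0] ty(4) by simp
    then show ?thesis
      unfolding ty(4) conical_profile_frontier[OF Q ty(1-3)]
      using ty by (simp add: mult.commute ennreal_leI flip: ennreal_mult)
  next
    case False
    then show ?thesis using conical_profile_outside[of ?Q x] Q interior_subset by (metis mult_zero_right subsetD zero_le)
  qed
qed

lemma nn_integral_conical_profile_cmult:
  fixes Q :: "'a::euclidean_space set"
  assumes "compact Q" "0 \<le> V"
  shows "(\<integral>\<^sup>+x. ennreal V * conical_profile Q x \<partial>lborel)
           = ennreal (V * measure lebesgue Q / real ((2 * DIM('a)) choose DIM('a)))"
  using assms borel_measurable_conical_profile[OF assms(1)]
  by (simp add: nn_integral_cmult nn_integral_conical_profile flip: ennreal_mult)

text \<open>Integrating the pointwise bound by the conical profile compares two integrals that are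
  both known exactly.\<close>

lemma rogers_shephard_overlap:
  fixes A B :: "'a::euclidean_space set"
  assumes A: "compact A" "convex A" and B: "compact B" "convex B" and int: "interior (A \<inter> B) \<noteq> {}"
  shows "measure lebesgue (difference_body A B) * measure lebesgue (A \<inter> B)
           \<le> real ((2 * DIM('a)) choose DIM('a)) * measure lebesgue A * measure lebesgue B"
proof -
  let ?Q = "difference_body A B" and ?V = "measure lebesgue (A \<inter> B)" and ?c = "real ((2 * DIM('a)) choose DIM('a))"
  have "(\<integral>\<^sup>+x. ennreal ?V * conical_profile ?Q x \<partial>lborel) \<le> (\<integral>\<^sup>+x. ennreal (measure lebesgue (overlap A B x)) \<partial>lborel)"
    by (intro nn_integral_mono conical_profile_le_measure_overlap[OF assms])
  then have "ennreal (?V * measure lebesgue ?Q / ?c) \<le> ennreal (measure lebesgue A * measure lebesgue B)"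
    using nn_integral_conical_profile_cmult[OF compact_difference_body[OF A(1) B(1)], of ?V]
      nn_integral_measure_overlap[OF A(1) B(1)] by simp
  then have "?V * measure lebesgue ?Q / ?c \<le> measure lebesgue A * measure lebesgue B"
    by (subst (asm) ennreal_le_iff) auto
  moreover have "?c > 0" by (simp add: zero_less_binomial)
  ultimately show ?thesis by (simp add: field_simps)
qed

text \<open>If the overlap at \<open>t *\<^sub>R y\<close> is too large, then it is uniformly too large on an open set of points
  slightly further out, because overlaps shrink slowly and the profile decreases outwards.\<close>

lemma measure_overlap_le_of_equality:
  fixes A B :: "'a::euclidean_space set"
  assumes A: "compact A" "convex A" and B: "compact B" "convex B" and int: "interior (A \<inter> B) \<noteq> {}"
    and eq: "measure lebesgue (difference_body A B) * measure lebesgue (A \<inter> B)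
           = real ((2 * DIM('a)) choose DIM('a)) * measure lebesgue A * measure lebesgue B"
    and y: "y \<in> frontier (difference_body A B)" and t: "0 \<le> t" "t < 1"
  shows "measure lebesgue (overlap A B (t *\<^sub>R y)) \<le> (1 - t) ^ DIM('a) * measure lebesgue (A \<inter> B)"
proof (rule ccontr)
  let ?n = "DIM('a)"
  define Q where "Q = difference_body A B"
  define V where "V = measure lebesgue (A \<inter> B)"
  define F where "F x = measure lebesgue (overlap A B x)" for x
  define H where "H = (1 - t) ^ ?n * V"
  define x1 where "x1 = t *\<^sub>R y"
  assume "\<not> ?thesis"
  then have G: "H < F x1" by (simp add: F_def H_def V_def x1_def)
  have Q: "compact Q" "convex Q" "0 \<in> interior Q"
    unfolding Q_def using difference_body_convex_body[OF A B int] by auto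
  have yQ: "y \<in> frontier Q" "y \<in> Q"
    using y Q(1) compact_imp_closed frontier_subset_closed unfolding Q_def by blast+
  have x1: "x1 \<in> interior Q" unfolding x1_def using shrink_mem_interior Q yQ t by blast
  have "((\<lambda>s. (1 - s) ^ ?n * F x1) \<longlongrightarrow> (1 - 0) ^ ?n * F x1) (at_right 0)"
    by (intro tendsto_intros)
  \<comment> \<open>A small move away from \<open>x1\<close> costs only a factor near 1, so the
    strict excess over \<open>H\<close> survives for some \<open>s > 0\<close>.\<close>
  then have "eventually (\<lambda>s. H < (1 - s) ^ ?n * F x1) (at_right 0)"
    using G by (intro order_tendstoD(1)) auto
  moreover have "eventually (\<lambda>s. s \<in> {0<..<1}) (at_right (0::real))"
    by (rule eventually_at_right_real) simp
  ultimately have "eventually (\<lambda>s. H < (1 - s) ^ ?n * F x1 \<and> s \<in> {0<..<1}) (at_right 0)"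
    by (rule eventually_conj)
  then obtain s where s: "0 < s" "s < 1" "H < (1 - s) ^ ?n * F x1"
    using eventually_happens'[OF trivial_limit_at_right_real] by (metis (lifting) greaterThanLessThan_iff)
  define d where "d = (1 - s) ^ ?n * F x1 - H"
  \<comment> \<open>Every point of \<open>W\<close> has overlap volume at least \<open>H + d\<close>
    by \<open>measure_overlap_ge\<close>. Removing the copy of \<open>Q\<close> scaled by
    \<open>t\<close> leaves points of gauge above \<open>t\<close>, where the profile times
    \<open>V\<close> is at most \<open>H\<close>.\<close>
  define W where "W = (\<lambda>q. (1 - s) *\<^sub>R x1 + s *\<^sub>R q) ` interior Q"
  define U where "U = W \<inter> - ((*\<^sub>R) t ` Q)"
  have "W = (+) ((1 - s) *\<^sub>R x1) ` ((*\<^sub>R) s ` interior Q)" by (auto simp: W_def image_image)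
  then have "open W" using s by (metis open_interior open_scaling open_translation less_irrefl)
  moreover have "compact ((*\<^sub>R) t ` Q)" using Q(1) compact_scaling by blast
  ultimately have "open U" unfolding U_def by (intro open_Int open_Compl compact_imp_closed)
  have "U \<noteq> {}"
  proof -
    have "x1 \<in> W" unfolding W_def using x1 by (intro image_eqI[of _ _ x1]) (auto simp: algebra_simps)
    then obtain r where r: "r > 0" "ball x1 r \<subseteq> W" using \<open>open W\<close> open_contains_ball by blast
    define e where "e = r / (norm y + 1)"
    have ny: "0 < norm y + 1" by (simp add: add_nonneg_pos)
    then have e: "0 < e" "e * norm y < r" using r by (auto simp: e_def field_simps)
    have "(t + e) *\<^sub>R y \<in> W"
      using e by (intro subsetD[OF r(2)]) (auto simp: x1_def dist_norm algebra_simps)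
    moreover have "(t + e) *\<^sub>R y \<notin> (*\<^sub>R) t ` Q"
      using scale_le_of_frontier_mem[OF Q(2,3) yQ(1) t(1), of "t + e"] e by auto
    ultimately show ?thesis by (auto simp: U_def)
  qed
  have WQ: "W \<subseteq> Q" unfolding W_def using s x1 interior_subset[of Q] by (auto intro!: convexD[OF Q(2)])
  have bound: "ennreal V * conical_profile Q x + ennreal d * indicator U x \<le> ennreal (F x)" for x
  proof (cases "x \<in> U")
    case True
    then obtain q where q: "q \<in> interior Q" "x = (1 - s) *\<^sub>R x1 + s *\<^sub>R q" by (auto simp: U_def W_def)
    have "x \<in> Q" using True WQ by (auto simp: U_def)
    then obtain t' y' where ty: "y' \<in> frontier Q" "0 \<le> t'" "t' \<le> 1" "x = t' *\<^sub>R y'"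
      using obtain_frontier_multiple[OF Q] by blast
    have y'Q: "y' \<in> Q" using ty(1) Q(1) compact_imp_closed frontier_subset_closed by blast
    have "t < t'"
    proof (rule ccontr)
      assume le: "\<not> t < t'"
      have "x \<in> (*\<^sub>R) t ` Q"
      proof (cases "t = 0")
        case True then show ?thesis using le ty y'Q by auto
      next
        case False
        have "(1 - t' / t) *\<^sub>R 0 + (t' / t) *\<^sub>R y' \<in> Q"
          using False le t ty y'Q Q(3) interior_subset by (intro convexD[OF Q(2)]) auto
        then show ?thesis using False ty by (intro image_eqI[of _ _ "(t' / t) *\<^sub>R y'"]) auto
      qed
      with True show False by (simp add: U_def)
    qed
    then have "V * (1 - t') ^ ?n \<le> H"
      unfolding H_def using ty by (subst mult.commute, intro mult_right_mono power_mono) (auto simp: V_def)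
    moreover have "(1 - s) ^ ?n * F x1 \<le> F x"
      unfolding F_def q(2) using s q interior_subset[of Q] Q_def
      by (intro measure_overlap_ge[OF A B]) auto
    ultimately have "V * (1 - t') ^ ?n + d \<le> F x" by (simp add: d_def)
    moreover have "0 \<le> d" using s by (simp add: d_def)
    moreover have "0 \<le> V" by (simp add: V_def)
    ultimately show ?thesis
      using True ty conical_profile_frontier[OF Q ty(1-3)] by (simp add: ennreal_leI flip: ennreal_mult ennreal_plus)
  next
    case False
    then show ?thesis
      using conical_profile_le_measure_overlap[OF A B int, of x] by (simp add: Q_def V_def F_def)
  qed
  have U: "U \<in> sets lborel" using \<open>open U\<close> by simp
  note meas = borel_measurable_conical_profile[OF Q(1)]
  let ?I = "V * measure lebesgue Q / real ((2 * ?n) choose ?n)"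
  have "(\<integral>\<^sup>+x. ennreal V * conical_profile Q x + ennreal d * indicator U x \<partial>lborel)
      \<le> (\<integral>\<^sup>+x. ennreal (F x) \<partial>lborel)"
    by (intro nn_integral_mono bound)
  also have "\<dots> = ennreal (measure lebesgue A * measure lebesgue B)"
    unfolding F_def by (rule nn_integral_measure_overlap[OF A(1) B(1)])
  also have "(\<integral>\<^sup>+x. ennreal V * conical_profile Q x + ennreal d * indicator U x \<partial>lborel)
      = ennreal ?I + ennreal d * emeasure lborel U"
    using U meas nn_integral_conical_profile_cmult[OF Q(1), of V]
    by (subst nn_integral_add) (auto simp: nn_integral_cmult_indicator V_def)
  also have "measure lebesgue A * measure lebesgue B = ?I"
    using eq by (simp add: Q_def V_def field_simps)
  \<comment> \<open>Equality leaves no room for the surplus \<open>d\<close> on \<open>U\<close>, so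
    \<open>U\<close> would be a null set although it is open and nonempty.\<close>
  finally have "ennreal ?I + ennreal d * emeasure lborel U \<le> ennreal ?I + 0" by simp
  then have "ennreal d * emeasure lborel U = 0"
    by (subst (asm) ennreal_add_left_cancel_le) auto
  moreover have "ennreal d \<noteq> 0" using s by (simp add: d_def)
  ultimately have "emeasure lborel U = 0" by simp
  then have "U \<in> null_sets lborel" using U by auto
  then have "negligible U" by (simp add: negligible_iff_null_sets null_sets_completionI)
  with open_not_negligible[OF \<open>open U\<close> \<open>U \<noteq> {}\<close>] show False by simp
qed

text \<open>The homothetic copy of \<open>A \<inter> B\<close> lies in the convex overlap and, under
  equality, has at least its volume, so it fills the overlap.\<close>

lemma homothetic_overlaps_of_equality:
  fixes A B :: "'a::euclidean_space set"
  assumes A: "compact A" "convex A" and B: "compact B" "convex B" and int: "interior (A \<inter> B) \<noteq> {}"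
    and eq: "measure lebesgue (difference_body A B) * measure lebesgue (A \<inter> B)
           = real ((2 * DIM('a)) choose DIM('a)) * measure lebesgue A * measure lebesgue B"
  shows "homothetic_overlaps A B"
  unfolding homothetic_overlaps_def
proof (intro ballI)
  fix y p t assume y: "y \<in> frontier (difference_body A B)" and p: "p \<in> overlap A B y" and t: "t \<in> {0..<1::real}"
  let ?h = "\<lambda>d. (1 - t) *\<^sub>R d + t *\<^sub>R p"
  have sub: "?h ` (A \<inter> B) \<subseteq> overlap A B (t *\<^sub>R y)"
    using overlap_combine[OF A(2) B(2) _ _ _ p, of t _ 0] t by auto
  have vol: "measure lebesgue (?h ` (A \<inter> B)) = (1 - t) ^ DIM('a) * measure lebesgue (A \<inter> B)"
    using measure_lebesgue_homothety[of "1 - t" "t *\<^sub>R p" "A \<inter> B"] t by simp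
  have comp: "compact (A \<inter> B)" using A B by (simp add: compact_Int)
  show "overlap A B (t *\<^sub>R y) \<subseteq> ?h ` (A \<inter> B)"
  proof (rule convex_subset_of_measure_le[OF _ _ _ _ sub])
    show "compact (?h ` (A \<inter> B))" by (intro compact_continuous_image comp continuous_intros)
    show "compact (overlap A B (t *\<^sub>R y))" "convex (overlap A B (t *\<^sub>R y))"
      using A B compact_overlap convex_overlap by auto
    have "measure lebesgue (?h ` (A \<inter> B)) > 0"
      using vol t measure_lebesgue_interior_pos[OF comp int] by simp
    then have "\<not> negligible (overlap A B (t *\<^sub>R y))"
      using sub negligible_subset negligible_imp_measure0 by (metis less_irrefl)
    then show "interior (overlap A B (t *\<^sub>R y)) \<noteq> {}"
      using negligible_convex_interior[OF \<open>convex (overlap A B (t *\<^sub>R y))\<close>] by simp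
    show "measure lebesgue (overlap A B (t *\<^sub>R y)) \<le> measure lebesgue (?h ` (A \<inter> B))"
      unfolding vol using measure_overlap_le_of_equality[OF assms y] t by simp
  qed
qed

text \<open>For a simplex the bound by the conical profile reverses: the overlap at a point of gauge
  at most \<open>l\<close> fits into a copy of \<open>K\<close> scaled by \<open>1 - l\<close>.
  Integration then reverses the inequality.\<close>

lemma simplex_difference_body_measure_ge:
  fixes K :: "'a::euclidean_space set"
  assumes K: "compact K" "convex K" "interior K \<noteq> {}" and simplex: "m simplex K"
  shows "real ((2 * DIM('a)) choose DIM('a)) * measure lebesgue K * measure lebesgue K
           \<le> measure lebesgue (difference_body K K) * measure lebesgue K"
proof -
  let ?Q = "difference_body K K" and ?V = "measure lebesgue K" and ?c = "real ((2 * DIM('a)) choose DIM('a))"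
  have Q: "compact ?Q" "convex ?Q" "0 \<in> interior ?Q"
    using difference_body_convex_body[OF K(1,2) K(1,2)] K(3) by auto
  have "ennreal (measure lebesgue (overlap K K x)) \<le> ennreal ?V * conical_profile ?Q x" for x
  proof (cases "x \<in> ?Q")
    case True
    obtain l w where l: "0 \<le> l" "l \<le> 1" "x \<in> (*\<^sub>R) l ` ?Q" "overlap K K x \<subseteq> (\<lambda>k. w + (1 - l) *\<^sub>R k) ` K"
      using simplex_overlap_subset[OF simplex True] by blast
    have "compact ((\<lambda>k. (1 - l) *\<^sub>R k + w) ` K)" by (intro compact_continuous_image K continuous_intros)
    then have "measure lebesgue (overlap K K x) \<le> measure lebesgue ((\<lambda>k. (1 - l) *\<^sub>R k + w) ` K)"
      using l(4) lmeasurable_compact lmeasurable_compact[OF compact_overlap[OF K(1) K(1), of x]]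
      by (intro measure_mono_fmeasurable) (auto simp: add.commute)
    also have "\<dots> = ?V * (1 - l) ^ DIM('a)"
      using measure_lebesgue_homothety[of "1 - l" w K] l by simp
    finally have "ennreal (measure lebesgue (overlap K K x)) \<le> ennreal ?V * ennreal ((1 - l) ^ DIM('a))"
      using l by (simp add: ennreal_leI flip: ennreal_mult)
    also have "\<dots> \<le> ennreal ?V * conical_profile ?Q x"
      by (intro mult_left_mono conical_profile_ge[OF Q l(1-3)]) simp
    finally show ?thesis .
  next
    case False
    then have "overlap K K x = {}" using overlap_nonempty_iff by blast
    then show ?thesis by simp
  qed
  then have "(\<integral>\<^sup>+x. ennreal (measure lebesgue (overlap K K x)) \<partial>lborel) \<le> (\<integral>\<^sup>+x. ennreal ?V * conical_profile ?Q x \<partial>lborel)"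
    by (intro nn_integral_mono)
  then have "ennreal (?V * ?V) \<le> ennreal (?V * measure lebesgue ?Q / ?c)"
    using nn_integral_conical_profile_cmult[OF Q(1), of ?V] nn_integral_measure_overlap[OF K(1) K(1)] by simp
  then have "?V * ?V \<le> ?V * measure lebesgue ?Q / ?c"
    by (subst (asm) ennreal_le_iff) auto
  moreover have "?c > 0" by (simp add: zero_less_binomial)
  ultimately show ?thesis by (simp add: field_simps)
qed

lemma rogers_shephard_overlap_eq_iff:
  fixes A B :: "'a::euclidean_space set"
  assumes A: "compact A" "convex A" and B: "compact B" "convex B" and int: "interior (A \<inter> B) \<noteq> {}"
  shows "measure lebesgue (difference_body A B) * measure lebesgue (A \<inter> B)
           = real ((2 * DIM('a)) choose DIM('a)) * measure lebesgue A * measure lebesgue B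
         \<longleftrightarrow> int DIM('a) simplex A \<and> A = B" (is "?eq \<longleftrightarrow> _")
proof
  assume ?eq
  then have hom: "homothetic_overlaps A B" by (rule homothetic_overlaps_of_equality[OF assms])
  then have "A = B" by (rule homothetic_overlaps_eq[OF assms])
  moreover have "int DIM('a) simplex A"
    using simplex_of_homothetic_overlaps[OF A] hom int \<open>A = B\<close> by simp
  ultimately show "int DIM('a) simplex A \<and> A = B" by simp
next
  assume "int DIM('a) simplex A \<and> A = B"
  then show ?eq
    using simplex_difference_body_measure_ge[OF A, of "int DIM('a)"] rogers_shephard_overlap[OF assms] int
    by (intro antisym) auto
qed

section \<open>Existence of a maximal section\<close>

text \<open>The overlap volume is upper semicontinuous and the difference body is compact.\<close>

lemma measure_overlap_attains_max:
  fixes A B :: "'a::euclidean_space set"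
  assumes "compact A" "compact B" "A \<noteq> {}" "B \<noteq> {}"
  obtains x where "x \<in> difference_body A B"
    "\<And>w. measure lebesgue (overlap A B w) \<le> measure lebesgue (overlap A B x)"
proof -
  let ?Q = "difference_body A B"
  define F where "F x = measure lebesgue (overlap A B x)" for x
  have upper: "\<exists>W. open W \<and> x \<in> W \<and> (\<forall>w\<in>W. F w < F x + e)" if "e > 0" for x e
  proof -
    have ov: "overlap A B w \<in> lmeasurable" for w using assms compact_overlap lmeasurable_compact by blast
    then have "overlap A B x \<in> sets lebesgue" by blast
    from sets_lebesgue_outer_open[OF this \<open>e > 0\<close>] obtain T where
      T: "open T" "overlap A B x \<subseteq> T" "T - overlap A B x \<in> lmeasurable"
        "emeasure lebesgue (T - overlap A B x) < ennreal e" by blast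
    have mT: "measure lebesgue (T - overlap A B x) < e"
      using T(3,4) \<open>e > 0\<close> by (simp add: emeasure_eq_measure2 ennreal_less_iff)
    \<comment> \<open>The translations whose overlap stays inside \<open>T\<close>: the complement
      of \<open>W\<close> consists of those where \<open>x + B\<close> meets the compact set
      \<open>A - T\<close>.\<close>
    define W where "W = - difference_body (A - T) B"
    have "compact (difference_body (A - T) B)"
      using assms T(1) by (intro compact_difference_body compact_diff) auto
    then have "open W" unfolding W_def using compact_imp_closed by blast
    moreover have "x \<in> W"
      using T(2) by (auto simp: W_def overlap_def simp flip: overlap_nonempty_iff)
    moreover have "F w < F x + e" if "w \<in> W" for w
    proof -
      have "overlap A B w \<subseteq> T"
        using that by (auto simp: W_def overlap_def simp flip: overlap_nonempty_iff)
      then have "overlap A B w \<subseteq> overlap A B x \<union> (T - overlap A B x)" by auto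
      then have "F w \<le> measure lebesgue (overlap A B x \<union> (T - overlap A B x))"
        unfolding F_def using ov T(3) by (intro measure_mono_fmeasurable fmeasurable.Un) auto
      also have "\<dots> \<le> F x + measure lebesgue (T - overlap A B x)"
        unfolding F_def using ov T(3) by (intro measure_Un_le) auto
      finally show ?thesis using mT by simp
    qed
    ultimately show ?thesis by blast
  qed
  have "\<exists>x\<in>?Q. \<forall>w\<in>?Q. F w \<le> F x"
  proof (rule ccontr)
    assume "\<not> ?thesis"
    then have "\<forall>x\<in>?Q. \<exists>w\<in>?Q. F x < F w" by (meson not_le)
    \<comment> \<open>Without a maximum each \<open>x\<close> has a strictly better
      \<open>g x\<close>, and semicontinuity keeps \<open>F\<close> below \<open>F (g x)\<close>
      near \<open>x\<close>. In a finite subcover the best value \<open>g c\<close> is itself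
      covered, hence beaten.\<close>
    then obtain g where g: "\<And>x. x \<in> ?Q \<Longrightarrow> g x \<in> ?Q" "\<And>x. x \<in> ?Q \<Longrightarrow> F x < F (g x)" by metis
    then have "\<forall>x\<in>?Q. \<exists>W. open W \<and> x \<in> W \<and> (\<forall>w\<in>W. F w < F (g x))"
      using upper[of "F (g x) - F x" x for x] by (metis add_diff_cancel_left' add_diff_eq diff_gt_0_iff_gt)
    then obtain W where W: "\<And>x. x \<in> ?Q \<Longrightarrow> open (W x)" "\<And>x. x \<in> ?Q \<Longrightarrow> x \<in> W x"
      "\<And>x w. x \<in> ?Q \<Longrightarrow> w \<in> W x \<Longrightarrow> F w < F (g x)" by metis
    have cov: "?Q \<subseteq> (\<Union>x\<in>?Q. W x)" using W(2) by blast
    obtain C where C: "C \<subseteq> ?Q" "finite C" "?Q \<subseteq> (\<Union>x\<in>C. W x)"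
      using compactE_image[OF compact_difference_body[OF assms(1,2)] _ cov] W(1) by metis
    have "?Q \<noteq> {}" using assms by (auto simp: difference_body_def)
    then have "C \<noteq> {}" using C(3) by auto
    obtain c where c: "c \<in> C" "\<And>x. x \<in> C \<Longrightarrow> F (g x) \<le> F (g c)"
    proof -
      have "Max ((\<lambda>x. F (g x)) ` C) \<in> (\<lambda>x. F (g x)) ` C" using C(2) \<open>C \<noteq> {}\<close> by (intro Max_in) auto
      then obtain c where "c \<in> C" "Max ((\<lambda>x. F (g x)) ` C) = F (g c)" by auto
      then show thesis using that[of c] C(2) by (metis Max_ge finite_imageI imageI)
    qed
    obtain x where x: "x \<in> C" "g c \<in> W x" using C c(1) g(1) by blast
    then have "F (g c) < F (g x)" using W(3) C(1) by blast
    with c(2)[OF x(1)] show False by simp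
  qed
  then obtain x where x: "x \<in> ?Q" "\<And>w. w \<in> ?Q \<Longrightarrow> F w \<le> F x" by blast
  have "F w \<le> F x" for w
  proof (cases "w \<in> ?Q")
    case False
    then have "overlap A B w = {}" using overlap_nonempty_iff by blast
    then show ?thesis by (simp add: F_def)
  qed (use x in simp)
  then show thesis using that x(1) by (simp add: F_def)
qed

lemma interior_overlap_nonempty:
  fixes A B :: "'a::real_normed_vector set"
  assumes "a \<in> interior A" "b \<in> interior B"
  shows "interior (overlap A B (a - b)) \<noteq> {}"
proof -
  let ?U = "interior A \<inter> (+) (a - b) ` interior B"
  have "open ?U" by (intro open_Int open_interior open_translation)
  moreover have "a \<in> ?U" using assms by (auto intro: image_eqI[of _ _ b])
  moreover have "?U \<subseteq> overlap A B (a - b)"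
    using interior_subset[of A] interior_subset[of B] by (auto simp: overlap_def)
  ultimately show ?thesis by (metis empty_iff interior_maximal subsetD)
qed

section \<open>Return to Minkowski sums and reflected bodies\<close>

lemma section_eq_overlap: "K \<inter> (\<lambda>y. x - y) ` L = overlap K (uminus ` L) (x :: 'a::real_vector)"
proof -
  have "z \<in> (\<lambda>y. x - y) ` L \<longleftrightarrow> z - x \<in> uminus ` L" for z
    by (auto simp: image_iff algebra_simps)
  then show ?thesis by (auto simp: overlap_def)
qed

lemma difference_body_uminus: "difference_body K (uminus ` L) = K + L"
proof -
  have "a + b \<in> difference_body K (uminus ` L)" if "a \<in> K" "b \<in> L" for a b
    unfolding difference_body_def using that by (intro CollectI exI[of _ a] exI[of _ "- b"]) auto
  then show ?thesis by (auto simp: difference_body_def elim!: set_plus_elim intro!: set_plus_intro)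
qed

lemma difference_body_translation:
  "difference_body A ((+) x ` B) = (+) (- x) ` difference_body A B"
proof -
  have "a - (x + b) \<in> (+) (- x) ` difference_body A B" if "a \<in> A" "b \<in> B" for a b
    using that by (intro image_eqI[of _ _ "a - b"]) (auto simp: difference_body_def)
  moreover have "- x + (a - b) \<in> difference_body A ((+) x ` B)" if "a \<in> A" "b \<in> B" for a b
    unfolding difference_body_def using that by (intro CollectI exI[of _ a] exI[of _ "x + b"]) auto
  ultimately show ?thesis by (auto simp: difference_body_def)
qed

text \<open>Apply the results for overlaps to \<open>K\<close> and the translate by \<open>x\<close>
  of the reflected \<open>L\<close>; translation and reflection preserve the volumes.\<close>

lemma rogers_shephard_translate:
  fixes K L :: "'a::euclidean_space set"
  assumes K: "compact K" "convex K" and L: "compact L" "convex L"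
    and int: "interior (overlap K (uminus ` L) x) \<noteq> {}"
  defines "V \<equiv> measure lebesgue (overlap K (uminus ` L) x)"
    and "c \<equiv> real ((2 * DIM('a)) choose DIM('a)) * measure lebesgue K * measure lebesgue L"
  shows "measure lebesgue (K + L) * V \<le> c"
    and "measure lebesgue (K + L) * V = c \<longleftrightarrow> int DIM('a) simplex K \<and> K = (\<lambda>y. x + y) ` uminus ` L"
proof -
  define B where "B = (\<lambda>y. x + y) ` uminus ` L"
  have B: "compact B" "convex B"
    unfolding B_def using L by (auto intro!: compact_translation compact_negations convex_translation convex_negations)
  have KB: "overlap K (uminus ` L) x = K \<inter> B"
    unfolding B_def by (force simp: overlap_def image_iff algebra_simps)
  have "difference_body K B = (+) (- x) ` (K + L)"
    unfolding B_def difference_body_translation difference_body_uminus ..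
  then have 1: "measure lebesgue (difference_body K B) = measure lebesgue (K + L)"
    using measure_translation by metis
  have "B = (\<lambda>y. (-1) *\<^sub>R y + x) ` L" by (auto simp: B_def image_image)
  then have 2: "measure lebesgue B = measure lebesgue L" using measure_lebesgue_affine[of "-1" x L] by simp
  show "measure lebesgue (K + L) * V \<le> c"
    using rogers_shephard_overlap[OF K B] int unfolding KB V_def c_def 1 2 by blast
  show "measure lebesgue (K + L) * V = c \<longleftrightarrow> int DIM('a) simplex K \<and> K = (\<lambda>y. x + y) ` uminus ` L"
    using rogers_shephard_overlap_eq_iff[OF K B] int unfolding KB V_def c_def 1 2 B_def[symmetric] by blast
qed

lemma max_section_eqI:
  assumes "x \<in> K + L"
    and "\<And>w. measure lebesgue (overlap K (uminus ` L) w) \<le> measure lebesgue (overlap K (uminus ` L) x)"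
  shows "max_section K L = measure lebesgue (overlap K (uminus ` L) x)"
  unfolding max_section_def section_eq_overlap
proof (rule cSup_eq_maximum)
  show "measure lebesgue (overlap K (uminus ` L) x) \<in> (\<lambda>x. measure lebesgue (overlap K (uminus ` L) x)) ` (K + L)"
    using assms(1) by (rule imageI)
  show "v \<le> measure lebesgue (overlap K (uminus ` L) x)"
    if "v \<in> (\<lambda>x. measure lebesgue (overlap K (uminus ` L) x)) ` (K + L)" for v
    using that assms(2) by blast
qed

theorem proposition4p7:
  fixes K L :: "(real ^ 'n) set"
  assumes "convex_body K" and "convex_body L"
  shows "measure lebesgue (K + L) * max_section K L
           \<le> real ((2 * CARD('n)) choose CARD('n)) * measure lebesgue K * measure lebesgue L
         \<and>
         (measure lebesgue (K + L) * max_section K L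
           = real ((2 * CARD('n)) choose CARD('n)) * measure lebesgue K * measure lebesgue L
          \<longleftrightarrow> int CARD('n) simplex K \<and> translate_of K (uminus ` L))"
proof -
  let ?L = "uminus ` L"
  have K: "compact K" "convex K" "interior K \<noteq> {}" and L: "compact L" "convex L" "interior L \<noteq> {}"
    using assms by (auto simp: convex_body_def)
  have L': "compact ?L" "convex ?L" "interior ?L \<noteq> {}"
    using L by (auto simp: compact_negations convex_negations interior_negations)
  have "K \<noteq> {}" "?L \<noteq> {}" using K(3) L'(3) by auto
  then obtain x where x: "x \<in> K + L" "\<And>w. measure lebesgue (overlap K ?L w) \<le> measure lebesgue (overlap K ?L x)"
    using measure_overlap_attains_max[OF K(1) L'(1)] unfolding difference_body_uminus by blast
  \<comment> \<open>Some overlap has positive volume, so every maximal one does. This is stated for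
    any maximizer \<open>z\<close> because both \<open>x\<close> and a translation vector of
    \<open>K\<close> onto the reflected \<open>L\<close> are used below.\<close>
  have int: "interior (overlap K ?L z) \<noteq> {}"
    if "\<And>w. measure lebesgue (overlap K ?L w) \<le> measure lebesgue (overlap K ?L z)" for z
  proof -
    obtain a b where ab: "a \<in> interior K" "b \<in> interior ?L" using K(3) L'(3) by auto
    have "0 < measure lebesgue (overlap K ?L (a - b))"
      by (intro measure_lebesgue_interior_pos compact_overlap K L' interior_overlap_nonempty ab)
    then have "measure lebesgue (overlap K ?L z) \<noteq> 0" using that[of "a - b"] by linarith
    then show ?thesis
      using negligible_convex_interior[OF convex_overlap[OF K(2) L'(2)]] negligible_imp_measure0 by blast
  qed
  note max = max_section_eqI[OF x] and rs = rogers_shephard_translate[OF K(1,2) L(1,2) int]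
  have "int CARD('n) simplex K \<and> translate_of K ?L
      \<Longrightarrow> measure lebesgue (K + L) * max_section K L
           = real ((2 * CARD('n)) choose CARD('n)) * measure lebesgue K * measure lebesgue L"
  proof (elim conjE)
    assume simplex: "int CARD('n) simplex K" and "translate_of K ?L"
    then obtain a where a: "K = (\<lambda>y. a + y) ` ?L" by (auto simp: translate_of_def)
    \<comment> \<open>At \<open>a\<close> the overlap is all of \<open>K\<close>, so
      \<open>a\<close> is a maximizer as well, and the equality criterion can be used at
      \<open>a\<close> instead of \<open>x\<close>.\<close>
    have Ka: "overlap K ?L a = K" using a by (force simp: overlap_def)
    have le: "measure lebesgue (overlap K ?L w) \<le> measure lebesgue (overlap K ?L a)" for w
      unfolding Ka using lmeasurable_compact[OF K(1)] lmeasurable_compact[OF compact_overlap[OF K(1) L'(1)]]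
      by (intro measure_mono_fmeasurable) (auto simp: overlap_def)
    have "max_section K L = measure lebesgue (overlap K ?L a)"
      unfolding max by (rule antisym[OF le x(2)])
    moreover have "int DIM(real ^ 'n) simplex K" using simplex by simp
    ultimately show ?thesis using rs(2)[OF le] a by simp
  qed
  moreover have "measure lebesgue (K + L) * max_section K L
           = real ((2 * CARD('n)) choose CARD('n)) * measure lebesgue K * measure lebesgue L
      \<Longrightarrow> int CARD('n) simplex K \<and> translate_of K ?L"
    using rs(2)[OF x(2)] unfolding max translate_of_def by auto
  moreover have "measure lebesgue (K + L) * max_section K L
      \<le> real ((2 * CARD('n)) choose CARD('n)) * measure lebesgue K * measure lebesgue L"
    using rs(1)[OF x(2)] unfolding max by simp
  ultimately show ?thesis by blast
qed

end
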